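(* Let $G$ be a finitely generated FC-group and let $A$ be a commutative unital ring. Then there is an isomorphism of $A$-modules $$\mathrm{Der}(A[G])\;\cong\;\mathrm{Inn}(A[G])\oplus\bigoplus_{[u]\in G^G}\mathrm{Hom}_{Ab}(Z(u),A).$$
   Context: An FC-group is a group all of whose conjugacy classes are finite. $A[G]$ is the group ring (finite $A$-linear combinations of elements of $G$). $\mathrm{Der}(A[G])$ is the $A$-module of derivations of $A[G]$: $A$-linear maps $d:A[G]\to A[G]$ with $d(xy)=d(x)y+x\,d(y)$ for all $x,y\in A[G]$. For $a\in A[G]$, $\mathrm{ad}_a(x)=ax-xa$. $\mathrm{Inn}(A[G])$ is the submodule of inner derivations, i.e. finite sums $\sum_{a\in G}C_a\,\mathrm{ad}_a$ with $C_a\in A$. $G^G$ is the set of conjugacy classes $[u]$ of $G$, and for each class a representative $u$ is fixed; $Z(u)$ is the centralizer of $u$ in $G$. For a group $H$, $\mathrm{Hom}_{Ab}(H,A)$ is the $A$-module (pointwise operations) of group homomorphisms from $H$ to the additive group of $A$. *)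

theory Defs
  imports "HOL-Algebra.Algebra"
begin

definition conj_action :: "('g, 'm) monoid_scheme \<Rightarrow> 'g \<Rightarrow> 'g \<Rightarrow> 'g" where
  "conj_action G = (\<lambda>g. \<lambda>u \<in> carrier G. g \<otimes>\<^bsub>G\<^esub> u \<otimes>\<^bsub>G\<^esub> inv\<^bsub>G\<^esub> g)"

definition conj_classes :: "('g, 'm) monoid_scheme \<Rightarrow> 'g set set" where
  "conj_classes G = orbits G (carrier G) (conj_action G)"

definition centralizer :: "('g, 'm) monoid_scheme \<Rightarrow> 'g \<Rightarrow> 'g set" where
  "centralizer G u = {g \<in> carrier G. g \<otimes>\<^bsub>G\<^esub> u = u \<otimes>\<^bsub>G\<^esub> g}"

definition FC_group :: "('g, 'm) monoid_scheme \<Rightarrow> bool" where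
  "FC_group G \<longleftrightarrow> group G \<and> (\<forall>K \<in> conj_classes G. finite K)"

definition finitely_generated_group :: "('g, 'm) monoid_scheme \<Rightarrow> bool" where
  "finitely_generated_group G \<longleftrightarrow>
     group G \<and> (\<exists>S. finite S \<and> S \<subseteq> carrier G \<and> generate G S = carrier G)"

text \<open>
  The library record for modules extends the record for rings. A module has no multiplication
  and no unit, and the library locale for modules ignores these two fields.
\<close>

definition mk_module ::
  "'b set \<Rightarrow> 'b \<Rightarrow> ('b \<Rightarrow> 'b \<Rightarrow> 'b) \<Rightarrow> ('a \<Rightarrow> 'b \<Rightarrow> 'b) \<Rightarrow> ('a, 'b) module" where
  "mk_module B z p s =
     \<lparr>carrier = B, monoid.mult = (\<lambda>_ _. undefined), one = undefined, ring.zero = z, add = p, smult = s\<rparr>"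

definition mod_hom ::
  "('a, 'r) ring_scheme \<Rightarrow> ('a, 'b, 'm) module_scheme \<Rightarrow> ('a, 'c, 'n) module_scheme
     \<Rightarrow> ('b \<Rightarrow> 'c) set" where
  "mod_hom A M N = {f \<in> carrier M \<rightarrow> carrier N.
     (\<forall>x \<in> carrier M. \<forall>y \<in> carrier M. f (x \<oplus>\<^bsub>M\<^esub> y) = f x \<oplus>\<^bsub>N\<^esub> f y) \<and>
     (\<forall>c \<in> carrier A. \<forall>x \<in> carrier M. f (c \<odot>\<^bsub>M\<^esub> x) = c \<odot>\<^bsub>N\<^esub> f x)}"

definition mod_isomorphic ::
  "('a, 'r) ring_scheme \<Rightarrow> ('a, 'b, 'm) module_scheme \<Rightarrow> ('a, 'c, 'n) module_scheme \<Rightarrow> bool" where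
  "mod_isomorphic A M N \<longleftrightarrow>
     module A M \<and> module A N \<and> (\<exists>f \<in> mod_hom A M N. bij_betw f (carrier M) (carrier N))"

definition mod_prod ::
  "('a, 'b, 'm) module_scheme \<Rightarrow> ('a, 'c, 'n) module_scheme \<Rightarrow> ('a, 'b \<times> 'c) module" where
  "mod_prod M N = mk_module (carrier M \<times> carrier N) (\<zero>\<^bsub>M\<^esub>, \<zero>\<^bsub>N\<^esub>)
     (\<lambda>(x, y) (x', y'). (x \<oplus>\<^bsub>M\<^esub> x', y \<oplus>\<^bsub>N\<^esub> y'))
     (\<lambda>c (x, y). (c \<odot>\<^bsub>M\<^esub> x, c \<odot>\<^bsub>N\<^esub> y))"

definition mod_direct_sum ::
  "'i set \<Rightarrow> ('i \<Rightarrow> ('a, 'b, 'm) module_scheme) \<Rightarrow> ('a, 'i \<Rightarrow> 'b) module" where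
  "mod_direct_sum I M = mk_module
     {x \<in> \<Pi>\<^sub>E i\<in>I. carrier (M i). finite {i \<in> I. x i \<noteq> \<zero>\<^bsub>M i\<^esub>}}
     (\<lambda>i\<in>I. \<zero>\<^bsub>M i\<^esub>)
     (\<lambda>x y. \<lambda>i\<in>I. x i \<oplus>\<^bsub>M i\<^esub> y i)
     (\<lambda>c x. \<lambda>i\<in>I. c \<odot>\<^bsub>M i\<^esub> x i)"

definition Hom_Ab ::
  "('h, 'm) monoid_scheme \<Rightarrow> ('a, 'r) ring_scheme \<Rightarrow> ('a, 'h \<Rightarrow> 'a) module" where
  "Hom_Ab H A = mk_module
     (hom H (add_monoid A) \<inter> extensional (carrier H))
     (\<lambda>h\<in>carrier H. \<zero>\<^bsub>A\<^esub>)
     (\<lambda>f k. \<lambda>h\<in>carrier H. f h \<oplus>\<^bsub>A\<^esub> k h)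
     (\<lambda>c f. \<lambda>h\<in>carrier H. c \<otimes>\<^bsub>A\<^esub> f h)"

definition support :: "('a, 'r) ring_scheme \<Rightarrow> ('g, 'm) monoid_scheme \<Rightarrow> ('g \<Rightarrow> 'a) \<Rightarrow> 'g set" where
  "support A G x = {g \<in> carrier G. x g \<noteq> \<zero>\<^bsub>A\<^esub>}"

text \<open>
  A finite linear combination of group elements is its coefficient function, extensional on
  the carrier of the group. The product has the coefficient at \<open>g\<close> equal to the
  sum of \<open>x h * y k\<close> over all factorizations \<open>g = h k\<close>.
\<close>

definition group_ring ::
  "('a, 'r) ring_scheme \<Rightarrow> ('g, 'm) monoid_scheme \<Rightarrow> ('a, 'g \<Rightarrow> 'a) module" where
  "group_ring A G =
     \<lparr>carrier = {x \<in> carrier G \<rightarrow>\<^sub>E carrier A. finite (support A G x)},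
      monoid.mult = (\<lambda>x y. \<lambda>g\<in>carrier G.
        \<Oplus>\<^bsub>A\<^esub>h \<in> support A G x. x h \<otimes>\<^bsub>A\<^esub> y (inv\<^bsub>G\<^esub> h \<otimes>\<^bsub>G\<^esub> g)),
      one = (\<lambda>g\<in>carrier G. if g = \<one>\<^bsub>G\<^esub> then \<one>\<^bsub>A\<^esub> else \<zero>\<^bsub>A\<^esub>),
      ring.zero = (\<lambda>g\<in>carrier G. \<zero>\<^bsub>A\<^esub>),
      add = (\<lambda>x y. \<lambda>g\<in>carrier G. x g \<oplus>\<^bsub>A\<^esub> y g),
      smult = (\<lambda>c x. \<lambda>g\<in>carrier G. c \<otimes>\<^bsub>A\<^esub> x g)\<rparr>"

definition grp_elt ::
  "('a, 'r) ring_scheme \<Rightarrow> ('g, 'm) monoid_scheme \<Rightarrow> 'g \<Rightarrow> 'g \<Rightarrow> 'a" where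
  "grp_elt A G u = (\<lambda>g\<in>carrier G. if g = u then \<one>\<^bsub>A\<^esub> else \<zero>\<^bsub>A\<^esub>)"

definition Der ::
  "('a, 'r) ring_scheme \<Rightarrow> ('a, 'b, 'm) module_scheme \<Rightarrow> ('a, 'b \<Rightarrow> 'b) module" where
  "Der A R = mk_module
     {d \<in> mod_hom A R R \<inter> extensional (carrier R).
        \<forall>x \<in> carrier R. \<forall>y \<in> carrier R. d (x \<otimes>\<^bsub>R\<^esub> y) = d x \<otimes>\<^bsub>R\<^esub> y \<oplus>\<^bsub>R\<^esub> x \<otimes>\<^bsub>R\<^esub> d y}
     (\<lambda>x\<in>carrier R. \<zero>\<^bsub>R\<^esub>)
     (\<lambda>d e. \<lambda>x\<in>carrier R. d x \<oplus>\<^bsub>R\<^esub> e x)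
     (\<lambda>c d. \<lambda>x\<in>carrier R. c \<odot>\<^bsub>R\<^esub> d x)"

definition ad :: "('b, 'm) ring_scheme \<Rightarrow> 'b \<Rightarrow> 'b \<Rightarrow> 'b" where
  "ad R a = (\<lambda>x\<in>carrier R. (a \<otimes>\<^bsub>R\<^esub> x) \<ominus>\<^bsub>R\<^esub> (x \<otimes>\<^bsub>R\<^esub> a))"

definition Inn ::
  "('a, 'r) ring_scheme \<Rightarrow> ('g, 'm) monoid_scheme \<Rightarrow> ('a, ('g \<Rightarrow> 'a) \<Rightarrow> ('g \<Rightarrow> 'a)) module" where
  "Inn A G = (Der A (group_ring A G))
     \<lparr>carrier := {\<Oplus>\<^bsub>Der A (group_ring A G)\<^esub>a \<in> F.
           C a \<odot>\<^bsub>Der A (group_ring A G)\<^esub> ad (group_ring A G) (grp_elt A G a)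
         | F C. finite F \<and> F \<subseteq> carrier G \<and> C \<in> F \<rightarrow> carrier A}\<rparr>"

end

theory Submission
  imports Defs
begin

text \<open>
  A derivation \<open>d\<close> of \<open>A[G]\<close> is the same thing as the 1-cocycle \<open>g \<mapsto> d(g) g\<inverse>\<close> of \<open>G\<close> with values in
  \<open>A[G]\<close> under conjugation, and inner derivations are the coboundaries. As \<open>G\<close> is finitely generated,
  a cocycle is nonzero on only finitely many of the summands \<open>A[K]\<close>, for \<open>K\<close> a conjugacy class, and as
  \<open>K\<close> is finite, \<open>A[K]\<close> is coinduced from the trivial module of \<open>Z(u)\<close>, \<open>u \<in> K\<close>. So Shapiro's lemma gives
  \<open>H\<^sup>1(G, A[K]) = Hom(Z(u), A)\<close>. Concretely, evaluating the cocycle at \<open>z \<in> Z(u)\<close> and taking the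
  coefficient of \<open>u\<close> is a linear map onto the direct sum of the \<open>Hom(Z(u), A)\<close> with kernel the inner
  derivations, and a transversal of \<open>Z(u)\<close> in \<open>G\<close> yields an explicit linear section.
\<close>

section \<open>Modules\<close>

text \<open>A cohomology computation alone gives only an exact sequence from \<open>Inn A G\<close>
  through \<open>Der\<close> to the direct sum. The terms Hom(Z(u), A) need not be projective over
  \<open>A\<close>, so a complement of the inner derivations cannot be had for free. This is why a
  linear section is written down, and why only its linearity and the fact that restriction undoes it
  are needed in the end. All objects consist of finitely supported functions, so each construction
  carries a finiteness obligation. Finite generation ensures that one derivation touches only
  finitely many conjugacy classes. This makes its family of homomorphisms lie in the direct sum
  rather than the product. Finiteness of the classes ensures that the cocycle built from such a
  family takes finitely supported values. Both together ensure that a coboundary found class by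
  class comes from an element of the group ring, so that the derivation is inner in the finite sense
  of \<open>Inn\<close>.\<close>

lemma mk_module_simps [simp]:
  "carrier (mk_module B z p s) = B"
  "\<zero>\<^bsub>mk_module B z p s\<^esub> = z"
  "x \<oplus>\<^bsub>mk_module B z p s\<^esub> y = p x y"
  "c \<odot>\<^bsub>mk_module B z p s\<^esub> x = s c x"
  by (simp_all add: mk_module_def)

text \<open>Additive inverses come for free as \<open>(\<ominus> \<one>) \<odot> x\<close>.\<close>

lemma module_from_smultI:
  fixes A (structure) and M (structure)
  assumes "cring A"
    and closed: "\<And>x y. \<lbrakk>x \<in> carrier M; y \<in> carrier M\<rbrakk> \<Longrightarrow> x \<oplus>\<^bsub>M\<^esub> y \<in> carrier M"
    and zero: "\<zero>\<^bsub>M\<^esub> \<in> carrier M"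
    and assoc: "\<And>x y z. \<lbrakk>x \<in> carrier M; y \<in> carrier M; z \<in> carrier M\<rbrakk>
      \<Longrightarrow> (x \<oplus>\<^bsub>M\<^esub> y) \<oplus>\<^bsub>M\<^esub> z = x \<oplus>\<^bsub>M\<^esub> (y \<oplus>\<^bsub>M\<^esub> z)"
    and comm: "\<And>x y. \<lbrakk>x \<in> carrier M; y \<in> carrier M\<rbrakk> \<Longrightarrow> x \<oplus>\<^bsub>M\<^esub> y = y \<oplus>\<^bsub>M\<^esub> x"
    and l_zero: "\<And>x. x \<in> carrier M \<Longrightarrow> \<zero>\<^bsub>M\<^esub> \<oplus>\<^bsub>M\<^esub> x = x"
    and smult_closed: "\<And>a x. \<lbrakk>a \<in> carrier A; x \<in> carrier M\<rbrakk> \<Longrightarrow> a \<odot>\<^bsub>M\<^esub> x \<in> carrier M"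
    and l_distr: "\<And>a b x. \<lbrakk>a \<in> carrier A; b \<in> carrier A; x \<in> carrier M\<rbrakk>
      \<Longrightarrow> (a \<oplus> b) \<odot>\<^bsub>M\<^esub> x = (a \<odot>\<^bsub>M\<^esub> x) \<oplus>\<^bsub>M\<^esub> (b \<odot>\<^bsub>M\<^esub> x)"
    and r_distr: "\<And>a x y. \<lbrakk>a \<in> carrier A; x \<in> carrier M; y \<in> carrier M\<rbrakk>
      \<Longrightarrow> a \<odot>\<^bsub>M\<^esub> (x \<oplus>\<^bsub>M\<^esub> y) = (a \<odot>\<^bsub>M\<^esub> x) \<oplus>\<^bsub>M\<^esub> (a \<odot>\<^bsub>M\<^esub> y)"
    and assoc1: "\<And>a b x. \<lbrakk>a \<in> carrier A; b \<in> carrier A; x \<in> carrier M\<rbrakk>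
      \<Longrightarrow> (a \<otimes> b) \<odot>\<^bsub>M\<^esub> x = a \<odot>\<^bsub>M\<^esub> (b \<odot>\<^bsub>M\<^esub> x)"
    and one: "\<And>x. x \<in> carrier M \<Longrightarrow> \<one> \<odot>\<^bsub>M\<^esub> x = x"
    and smult_zero: "\<And>x. x \<in> carrier M \<Longrightarrow> \<zero> \<odot>\<^bsub>M\<^esub> x = \<zero>\<^bsub>M\<^esub>"
  shows "module A M"
proof -
  interpret A: cring A by fact
  have inv: "\<exists>y \<in> carrier M. y \<oplus>\<^bsub>M\<^esub> x = \<zero>\<^bsub>M\<^esub>" if x: "x \<in> carrier M" for x
  proof
    show "(\<ominus> \<one>) \<odot>\<^bsub>M\<^esub> x \<in> carrier M"
      using smult_closed x by simp
    show "(\<ominus> \<one>) \<odot>\<^bsub>M\<^esub> x \<oplus>\<^bsub>M\<^esub> x = \<zero>\<^bsub>M\<^esub>"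
      using l_distr[of "\<ominus> \<one>" \<one> x] x one smult_zero by (simp add: A.l_neg)
  qed
  have "abelian_group M"
    by (rule abelian_groupI) (use closed zero assoc comm l_zero inv in auto)
  then show ?thesis
    using assms by (intro moduleI) auto
qed

section \<open>Products, direct sums and Hom modules\<close>

lemma module_mod_prod:
  assumes "module A M" "module A N"
  shows "module A (mod_prod M N)"
proof -
  interpret M: module A M by fact
  interpret N: module A N by fact
  show ?thesis
    by (rule module_from_smultI)
      (auto simp: mod_prod_def M.M.a_assoc N.M.a_assoc M.smult_l_distr N.smult_l_distr
        M.smult_r_distr N.smult_r_distr M.smult_assoc1 N.smult_assoc1
        intro: M.M.a_comm N.M.a_comm M.R.is_cring)
qed

lemma module_mod_direct_sum:
  assumes "cring A" and M: "\<And>i. i \<in> I \<Longrightarrow> module A (M i)"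
  shows "module A (mod_direct_sum I M)"
proof -
  interpret A: cring A by fact
  have ab: "abelian_group (M i)" if "i \<in> I" for i
    using M[OF that] by (simp add: module_def)
  note am = ab[THEN abelian_group.axioms(1)]
  note [simp] = abelian_monoid.a_closed[OF am] abelian_monoid.zero_closed[OF am]
    abelian_monoid.l_zero[OF am] module.smult_closed[OF M] module.smult_r_null[OF M]
    module.smult_l_null[OF M] module.smult_one[OF M]
  have mem [simp]: "x i \<in> carrier (M i)" if "x \<in> (\<Pi>\<^sub>E i\<in>I. carrier (M i))" "i \<in> I" for x i
    using that by auto
  let ?fin = "\<lambda>x. finite {i \<in> I. x i \<noteq> \<zero>\<^bsub>M i\<^esub>}"
  have fin_add: "?fin (\<lambda>i\<in>I. x i \<oplus>\<^bsub>M i\<^esub> y i)" if "?fin x" "?fin y" for x y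
    by (rule finite_subset[OF _ finite_UnI[OF that]]) auto
  have fin_smult: "?fin (\<lambda>i\<in>I. c \<odot>\<^bsub>M i\<^esub> x i)" if "?fin x" "c \<in> carrier A" for c x
    by (rule finite_subset[OF _ that(1)]) (use that(2) in auto)
  show ?thesis
  proof (rule module_from_smultI)
    fix x y assume xy: "x \<in> carrier (mod_direct_sum I M)" "y \<in> carrier (mod_direct_sum I M)"
    then show "x \<oplus>\<^bsub>mod_direct_sum I M\<^esub> y \<in> carrier (mod_direct_sum I M)"
      using fin_add[of x y] by (auto simp: mod_direct_sum_def)
    show "x \<oplus>\<^bsub>mod_direct_sum I M\<^esub> y = y \<oplus>\<^bsub>mod_direct_sum I M\<^esub> x"
      using xy by (auto simp: mod_direct_sum_def intro!: restrict_ext abelian_monoid.a_comm[OF am])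
    fix a assume a: "a \<in> carrier A"
    show "a \<odot>\<^bsub>mod_direct_sum I M\<^esub> x \<in> carrier (mod_direct_sum I M)"
      using fin_smult[of x a] xy a by (auto simp: mod_direct_sum_def)
    show "a \<odot>\<^bsub>mod_direct_sum I M\<^esub> (x \<oplus>\<^bsub>mod_direct_sum I M\<^esub> y) =
      a \<odot>\<^bsub>mod_direct_sum I M\<^esub> x \<oplus>\<^bsub>mod_direct_sum I M\<^esub> a \<odot>\<^bsub>mod_direct_sum I M\<^esub> y"
      using xy a by (auto simp: mod_direct_sum_def module.smult_r_distr[OF M] intro!: restrict_ext)
  next
    fix x assume x: "x \<in> carrier (mod_direct_sum I M)"
    show "\<zero>\<^bsub>mod_direct_sum I M\<^esub> \<oplus>\<^bsub>mod_direct_sum I M\<^esub> x = x"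
      and "\<one>\<^bsub>A\<^esub> \<odot>\<^bsub>mod_direct_sum I M\<^esub> x = x"
      using x by (auto simp: mod_direct_sum_def PiE_iff extensional_def fun_eq_iff)
    show "\<zero>\<^bsub>A\<^esub> \<odot>\<^bsub>mod_direct_sum I M\<^esub> x = \<zero>\<^bsub>mod_direct_sum I M\<^esub>"
      using x by (auto simp: mod_direct_sum_def intro!: restrict_ext)
    fix a b assume ab: "a \<in> carrier A" "b \<in> carrier A"
    show "(a \<oplus>\<^bsub>A\<^esub> b) \<odot>\<^bsub>mod_direct_sum I M\<^esub> x =
      a \<odot>\<^bsub>mod_direct_sum I M\<^esub> x \<oplus>\<^bsub>mod_direct_sum I M\<^esub> b \<odot>\<^bsub>mod_direct_sum I M\<^esub> x"
      using x ab by (auto simp: mod_direct_sum_def module.smult_l_distr[OF M] intro!: restrict_ext)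
    show "(a \<otimes>\<^bsub>A\<^esub> b) \<odot>\<^bsub>mod_direct_sum I M\<^esub> x =
      a \<odot>\<^bsub>mod_direct_sum I M\<^esub> (b \<odot>\<^bsub>mod_direct_sum I M\<^esub> x)"
      using x ab by (auto simp: mod_direct_sum_def module.smult_assoc1[OF M] intro!: restrict_ext)
  next
    fix x y z assume "x \<in> carrier (mod_direct_sum I M)" "y \<in> carrier (mod_direct_sum I M)"
      "z \<in> carrier (mod_direct_sum I M)"
    then show "x \<oplus>\<^bsub>mod_direct_sum I M\<^esub> y \<oplus>\<^bsub>mod_direct_sum I M\<^esub> z =
      x \<oplus>\<^bsub>mod_direct_sum I M\<^esub> (y \<oplus>\<^bsub>mod_direct_sum I M\<^esub> z)"
      by (auto simp: mod_direct_sum_def abelian_monoid.a_assoc[OF am] intro!: restrict_ext)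
  qed (auto simp: mod_direct_sum_def A.is_cring)
qed

lemma module_Hom_Ab:
  assumes "group H" "cring A"
  shows "module A (Hom_Ab H A)"
proof -
  interpret H: group H by fact
  interpret A: cring A by fact
  have homD: "f x \<in> carrier A" if "f \<in> hom H (add_monoid A)" "x \<in> carrier H" for f x
    using that by (auto simp: hom_def)
  have homM: "f (x \<otimes>\<^bsub>H\<^esub> y) = f x \<oplus>\<^bsub>A\<^esub> f y"
    if "f \<in> hom H (add_monoid A)" "x \<in> carrier H" "y \<in> carrier H" for f x y
    using that by (auto simp: hom_def)
  show ?thesis
  proof (rule module_from_smultI)
    fix f k assume fk: "f \<in> carrier (Hom_Ab H A)" "k \<in> carrier (Hom_Ab H A)"
    then have "(\<lambda>h\<in>carrier H. f h \<oplus>\<^bsub>A\<^esub> k h) \<in> hom H (add_monoid A)"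
      by (intro homI) (auto simp: Hom_Ab_def homD homM A.a_ac)
    then show "f \<oplus>\<^bsub>Hom_Ab H A\<^esub> k \<in> carrier (Hom_Ab H A)"
      by (simp add: Hom_Ab_def)
    fix c assume c: "c \<in> carrier A"
    have "(\<lambda>h\<in>carrier H. c \<otimes>\<^bsub>A\<^esub> f h) \<in> hom H (add_monoid A)"
      using fk c by (intro homI) (auto simp: Hom_Ab_def homD homM A.r_distr)
    then show "c \<odot>\<^bsub>Hom_Ab H A\<^esub> f \<in> carrier (Hom_Ab H A)"
      by (simp add: Hom_Ab_def)
  next
    have "(\<lambda>h\<in>carrier H. \<zero>\<^bsub>A\<^esub>) \<in> hom H (add_monoid A)"
      by (intro homI) auto
    then show "\<zero>\<^bsub>Hom_Ab H A\<^esub> \<in> carrier (Hom_Ab H A)"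
      by (simp add: Hom_Ab_def)
  next
    fix f assume "f \<in> carrier (Hom_Ab H A)"
    then show "\<zero>\<^bsub>Hom_Ab H A\<^esub> \<oplus>\<^bsub>Hom_Ab H A\<^esub> f = f" "\<one>\<^bsub>A\<^esub> \<odot>\<^bsub>Hom_Ab H A\<^esub> f = f"
      by (auto simp: Hom_Ab_def homD extensional_def fun_eq_iff)
  qed (auto simp: Hom_Ab_def homD A.a_assoc A.m_assoc A.l_distr A.r_distr
      intro!: restrict_ext A.a_comm A.is_cring)
qed

section \<open>Module homomorphisms and split surjections\<close>

lemma mod_homD:
  assumes "f \<in> mod_hom A M N"
  shows "x \<in> carrier M \<Longrightarrow> f x \<in> carrier N"
    and "\<lbrakk>x \<in> carrier M; y \<in> carrier M\<rbrakk> \<Longrightarrow> f (x \<oplus>\<^bsub>M\<^esub> y) = f x \<oplus>\<^bsub>N\<^esub> f y"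
    and "\<lbrakk>c \<in> carrier A; x \<in> carrier M\<rbrakk> \<Longrightarrow> f (c \<odot>\<^bsub>M\<^esub> x) = c \<odot>\<^bsub>N\<^esub> f x"
  using assms by (auto simp: mod_hom_def)

lemma mod_homI:
  assumes "\<And>x. x \<in> carrier M \<Longrightarrow> f x \<in> carrier N"
    and "\<And>x y. \<lbrakk>x \<in> carrier M; y \<in> carrier M\<rbrakk> \<Longrightarrow> f (x \<oplus>\<^bsub>M\<^esub> y) = f x \<oplus>\<^bsub>N\<^esub> f y"
    and "\<And>c x. \<lbrakk>c \<in> carrier A; x \<in> carrier M\<rbrakk> \<Longrightarrow> f (c \<odot>\<^bsub>M\<^esub> x) = c \<odot>\<^bsub>N\<^esub> f x"
  shows "f \<in> mod_hom A M N"
  using assms by (auto simp: mod_hom_def)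

lemma mod_hom_compose:
  assumes "f \<in> mod_hom A L M" "k \<in> mod_hom A M N"
  shows "(\<lambda>x. k (f x)) \<in> mod_hom A L N"
  by (rule mod_homI) (simp_all add: mod_homD[OF assms(1)] mod_homD[OF assms(2)])

lemma mod_hom_add:
  assumes "module A N" and f: "f \<in> mod_hom A M N" and k: "k \<in> mod_hom A M N"
  shows "(\<lambda>x. f x \<oplus>\<^bsub>N\<^esub> k x) \<in> mod_hom A M N"
proof -
  interpret N: module A N by fact
  show ?thesis
    by (rule mod_homI) (simp_all add: mod_homD[OF f] mod_homD[OF k] N.M.a_ac N.smult_r_distr)
qed

lemma mod_hom_zero:
  assumes "module A M" "module A N" "f \<in> mod_hom A M N"
  shows "f \<zero>\<^bsub>M\<^esub> = \<zero>\<^bsub>N\<^esub>"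
proof -
  interpret M: module A M by fact
  interpret N: module A N by fact
  have "f \<zero>\<^bsub>M\<^esub> = f (\<zero>\<^bsub>A\<^esub> \<odot>\<^bsub>M\<^esub> \<zero>\<^bsub>M\<^esub>)"
    by simp
  also have "\<dots> = \<zero>\<^bsub>A\<^esub> \<odot>\<^bsub>N\<^esub> f \<zero>\<^bsub>M\<^esub>"
    by (rule mod_homD(3)[OF assms(3)]) simp_all
  also have "\<dots> = \<zero>\<^bsub>N\<^esub>"
    using mod_homD(1)[OF assms(3)] by simp
  finally show ?thesis .
qed

text \<open>Every x is (x - s (r x)) + s (r x), with the first summand in the kernel of
  \<open>r\<close>; so x goes to (x - s (r x), r x), with inverse (k, y) to k + s y. The kernel
  appears as a record update of \<open>M\<close> because \<open>Inn A G\<close> is an update of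
  \<open>Der\<close> of the same shape.\<close>

lemma split_epi_mod_isomorphic:
  assumes M: "module A M" and N: "module A N"
    and r: "r \<in> mod_hom A M N" and s: "s \<in> mod_hom A N M"
    and rs: "\<And>y. y \<in> carrier N \<Longrightarrow> r (s y) = y"
  shows "mod_isomorphic A M
    (mod_prod (M\<lparr>carrier := {x \<in> carrier M. r x = \<zero>\<^bsub>N\<^esub>}\<rparr>) N)"
proof -
  interpret M: module A M by fact
  interpret N: module A N by fact
  define K where "K = {x \<in> carrier M. r x = \<zero>\<^bsub>N\<^esub>}"
  note rD = mod_homD[OF r] and sD = mod_homD[OF s]
  have r0: "r \<zero>\<^bsub>M\<^esub> = \<zero>\<^bsub>N\<^esub>"
    using mod_hom_zero[OF M N r] .
  have neg: "\<ominus>\<^bsub>M\<^esub> x = (\<ominus>\<^bsub>A\<^esub> \<one>\<^bsub>A\<^esub>) \<odot>\<^bsub>M\<^esub> x" if "x \<in> carrier M" for x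
    using that M.smult_l_minus[of "\<one>\<^bsub>A\<^esub>" x] by simp
  have negN: "\<ominus>\<^bsub>N\<^esub> x = (\<ominus>\<^bsub>A\<^esub> \<one>\<^bsub>A\<^esub>) \<odot>\<^bsub>N\<^esub> x" if "x \<in> carrier N" for x
    using that N.smult_l_minus[of "\<one>\<^bsub>A\<^esub>" x] by simp
  have sub: "submodule K A M"
    by (rule M.module_incl_imp_submodule[rotated], rule module_from_smultI)
      (auto simp: K_def rD r0 M.M.a_assoc M.smult_l_distr M.smult_r_distr M.smult_assoc1
        intro: M.M.a_comm M.R.is_cring)
  have modK: "module A (M\<lparr>carrier := K\<rparr>)"
    by (rule submodule.submodule_is_module[OF sub M])
  \<comment> \<open>The projection onto the kernel along the image of \<open>s\<close>. Writing the
    negative as multiplication by minus one lets the linearity rules for scalars handle it.\<close>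
  define q where "q x = x \<oplus>\<^bsub>M\<^esub> (\<ominus>\<^bsub>A\<^esub> \<one>\<^bsub>A\<^esub>) \<odot>\<^bsub>M\<^esub> s (r x)" for x
  have qK: "q x \<in> K" if "x \<in> carrier M" for x
    using that by (simp add: q_def K_def rD sD rs negN[symmetric] N.M.r_neg)
  have q_add: "q (x \<oplus>\<^bsub>M\<^esub> y) = q x \<oplus>\<^bsub>M\<^esub> q y" if "x \<in> carrier M" "y \<in> carrier M" for x y
    using that by (simp add: q_def rD sD M.smult_r_distr M.M.a_ac)
  have q_smult: "q (c \<odot>\<^bsub>M\<^esub> x) = c \<odot>\<^bsub>M\<^esub> q x" if "c \<in> carrier A" "x \<in> carrier M" for c x
    using that by (simp add: q_def rD sD M.smult_r_distr M.smult_assoc1[symmetric] M.R.m_comm)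
  let ?P = "mod_prod (M\<lparr>carrier := K\<rparr>) N"
  have "(\<lambda>x. (q x, r x)) \<in> mod_hom A M ?P"
    by (rule mod_homI) (auto simp: mod_prod_def qK q_add q_smult rD)
  moreover have "bij_betw (\<lambda>x. (q x, r x)) (carrier M) (carrier ?P)"
  proof (rule bij_betw_byWitness[where f' = "\<lambda>(k, y). k \<oplus>\<^bsub>M\<^esub> s y"])
    show "\<forall>x\<in>carrier M. (case (q x, r x) of (k, y) \<Rightarrow> k \<oplus>\<^bsub>M\<^esub> s y) = x"
      by (auto simp: q_def rD sD M.M.a_assoc neg[symmetric] M.M.l_neg)
    show "\<forall>p\<in>carrier ?P. (q (case p of (k, y) \<Rightarrow> k \<oplus>\<^bsub>M\<^esub> s y), r (case p of (k, y) \<Rightarrow> k \<oplus>\<^bsub>M\<^esub> s y)) = p"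
      by (auto simp: q_def mod_prod_def K_def rD sD rs M.M.a_assoc neg[symmetric] M.M.r_neg)
    show "(\<lambda>x. (q x, r x)) ` carrier M \<subseteq> carrier ?P"
      by (auto simp: mod_prod_def qK rD)
    show "(\<lambda>(k, y). k \<oplus>\<^bsub>M\<^esub> s y) ` carrier ?P \<subseteq> carrier M"
      by (auto simp: mod_prod_def K_def sD)
  qed
  ultimately show ?thesis
    unfolding mod_isomorphic_def K_def[symmetric]
    using M module_mod_prod[OF modK N] by blast
qed

section \<open>Derivations of an algebra\<close>

text \<open>The group ring is noncommutative in general, so scalars have to be movable out of the
  left and the right factor by two separate rules.\<close>

locale assoc_algebra = module + ring M +
  assumes smult_mult_left: "\<lbrakk>c \<in> carrier R; x \<in> carrier M; y \<in> carrier M\<rbrakk>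
      \<Longrightarrow> (c \<odot>\<^bsub>M\<^esub> x) \<otimes>\<^bsub>M\<^esub> y = c \<odot>\<^bsub>M\<^esub> (x \<otimes>\<^bsub>M\<^esub> y)"
    and smult_mult_right: "\<lbrakk>c \<in> carrier R; x \<in> carrier M; y \<in> carrier M\<rbrakk>
      \<Longrightarrow> x \<otimes>\<^bsub>M\<^esub> (c \<odot>\<^bsub>M\<^esub> y) = c \<odot>\<^bsub>M\<^esub> (x \<otimes>\<^bsub>M\<^esub> y)"

lemma DerD:
  assumes "d \<in> carrier (Der A R)"
  shows "d \<in> mod_hom A R R" and "d \<in> extensional (carrier R)"
    and "\<lbrakk>x \<in> carrier R; y \<in> carrier R\<rbrakk>
      \<Longrightarrow> d (x \<otimes>\<^bsub>R\<^esub> y) = d x \<otimes>\<^bsub>R\<^esub> y \<oplus>\<^bsub>R\<^esub> x \<otimes>\<^bsub>R\<^esub> d y"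
  using assms by (auto simp: Der_def)

lemma DerI:
  assumes "d \<in> mod_hom A R R" and "d \<in> extensional (carrier R)"
    and "\<And>x y. \<lbrakk>x \<in> carrier R; y \<in> carrier R\<rbrakk>
      \<Longrightarrow> d (x \<otimes>\<^bsub>R\<^esub> y) = d x \<otimes>\<^bsub>R\<^esub> y \<oplus>\<^bsub>R\<^esub> x \<otimes>\<^bsub>R\<^esub> d y"
  shows "d \<in> carrier (Der A R)"
  using assms by (auto simp: Der_def)

lemma Der_closed: "\<lbrakk>d \<in> carrier (Der A R); x \<in> carrier R\<rbrakk> \<Longrightarrow> d x \<in> carrier R"
  by (meson DerD(1) mod_homD(1))

lemma Der_apply [simp]:
  assumes "x \<in> carrier R"
  shows "(d \<oplus>\<^bsub>Der A R\<^esub> e) x = d x \<oplus>\<^bsub>R\<^esub> e x"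
    and "(c \<odot>\<^bsub>Der A R\<^esub> d) x = c \<odot>\<^bsub>R\<^esub> d x"
    and "\<zero>\<^bsub>Der A R\<^esub> x = \<zero>\<^bsub>R\<^esub>"
  using assms by (simp_all add: Der_def)

lemma Der_extensional:
  "d \<oplus>\<^bsub>Der A R\<^esub> e \<in> extensional (carrier R)"
  "c \<odot>\<^bsub>Der A R\<^esub> d \<in> extensional (carrier R)"
  "\<zero>\<^bsub>Der A R\<^esub> \<in> extensional (carrier R)"
  by (simp_all add: Der_def)

context assoc_algebra
begin

text \<open>The operations are pointwise, so the module laws are inherited from \<open>M\<close>;
  only closure under the Leibniz rule has content. For scalar multiples it rests on both rules that
  move scalars through products.\<close>

lemma module_Der: "module R (Der R M)"
proof -
  let ?D = "Der R M"
  have add: "d \<oplus>\<^bsub>?D\<^esub> e \<in> carrier ?D" if d: "d \<in> carrier ?D" and e: "e \<in> carrier ?D" for d e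
    by (rule DerI, rule mod_homI)
      (simp_all add: Der_extensional Der_closed[OF d] Der_closed[OF e] DerD(3)[OF d] DerD(3)[OF e]
        mod_homD[OF DerD(1)[OF d]] mod_homD[OF DerD(1)[OF e]]
        M.a_ac l_distr r_distr smult_r_distr)
  have smult: "c \<odot>\<^bsub>?D\<^esub> d \<in> carrier ?D" if d: "d \<in> carrier ?D" and c: "c \<in> carrier R" for c d
    by (rule DerI, rule mod_homI)
      (simp_all add: c Der_extensional Der_closed[OF d] DerD(3)[OF d] mod_homD[OF DerD(1)[OF d]]
        smult_r_distr smult_mult_left smult_mult_right smult_assoc1[symmetric] R.m_comm)
  have zero: "\<zero>\<^bsub>?D\<^esub> \<in> carrier ?D"
    by (rule DerI, rule mod_homI) (simp_all add: Der_extensional)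
  have eq: "d = e" if "d \<in> extensional (carrier M)" "e \<in> extensional (carrier M)"
    "\<And>x. x \<in> carrier M \<Longrightarrow> d x = e x" for d e
    using that by (rule extensionalityI)
  have comm: "d x \<oplus>\<^bsub>M\<^esub> e x = e x \<oplus>\<^bsub>M\<^esub> d x"
    if "d \<in> carrier ?D" "e \<in> carrier ?D" "x \<in> carrier M" for d e x
    using that by (simp add: Der_closed M.a_comm)
  show ?thesis
    by (rule module_from_smultI)
      (auto intro!: eq Der_extensional add smult zero DerD(2) R.is_cring
        simp: Der_closed M.a_assoc smult_l_distr smult_r_distr smult_assoc1 comm)
qed

text \<open>The Leibniz rule telescopes: (axy - xay) + (xay - xya) = axy - xya.\<close>

lemma ad_in_Der:
  assumes "a \<in> carrier M"
  shows "ad M a \<in> carrier (Der R M)"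
proof -
  have sum: "(u \<ominus>\<^bsub>M\<^esub> v) \<oplus>\<^bsub>M\<^esub> (v \<ominus>\<^bsub>M\<^esub> w) = u \<ominus>\<^bsub>M\<^esub> w"
    if "u \<in> carrier M" "v \<in> carrier M" "w \<in> carrier M" for u v w
    using that by (simp add: M.minus_eq M.a_assoc M.r_neg1)
  have swap: "(x \<oplus>\<^bsub>M\<^esub> y) \<ominus>\<^bsub>M\<^esub> (z \<oplus>\<^bsub>M\<^esub> w) = (x \<ominus>\<^bsub>M\<^esub> z) \<oplus>\<^bsub>M\<^esub> (y \<ominus>\<^bsub>M\<^esub> w)"
    if "x \<in> carrier M" "y \<in> carrier M" "z \<in> carrier M" "w \<in> carrier M" for x y z w
    using that by (simp add: M.minus_eq M.minus_add M.a_ac)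
  show ?thesis
  proof (rule DerI, rule mod_homI)
    fix x y assume xy: "x \<in> carrier M" "y \<in> carrier M"
    show "ad M a (x \<oplus>\<^bsub>M\<^esub> y) = ad M a x \<oplus>\<^bsub>M\<^esub> ad M a y"
      using assms xy by (simp add: ad_def l_distr r_distr swap)
    have "ad M a x \<otimes>\<^bsub>M\<^esub> y \<oplus>\<^bsub>M\<^esub> x \<otimes>\<^bsub>M\<^esub> ad M a y =
      (a \<otimes>\<^bsub>M\<^esub> x \<otimes>\<^bsub>M\<^esub> y \<ominus>\<^bsub>M\<^esub> x \<otimes>\<^bsub>M\<^esub> a \<otimes>\<^bsub>M\<^esub> y) \<oplus>\<^bsub>M\<^esub> (x \<otimes>\<^bsub>M\<^esub> a \<otimes>\<^bsub>M\<^esub> y \<ominus>\<^bsub>M\<^esub> x \<otimes>\<^bsub>M\<^esub> y \<otimes>\<^bsub>M\<^esub> a)"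
      using assms xy by (simp add: ad_def M.minus_eq l_distr r_distr l_minus r_minus m_assoc)
    also have "\<dots> = ad M a (x \<otimes>\<^bsub>M\<^esub> y)"
      using assms xy by (simp add: sum) (simp add: ad_def m_assoc)
    finally show "ad M a (x \<otimes>\<^bsub>M\<^esub> y) = ad M a x \<otimes>\<^bsub>M\<^esub> y \<oplus>\<^bsub>M\<^esub> x \<otimes>\<^bsub>M\<^esub> ad M a y" ..
  next
    fix c x assume "c \<in> carrier R" "x \<in> carrier M"
    then show "ad M a (c \<odot>\<^bsub>M\<^esub> x) = c \<odot>\<^bsub>M\<^esub> ad M a x"
      using assms by (simp add: ad_def smult_mult_left smult_mult_right M.minus_eq smult_r_distr smult_r_minus)
  qed (use assms in \<open>simp_all add: ad_def\<close>)
qed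

end

section \<open>The group ring\<close>

locale group_algebra = group G + A: cring A for G (structure) and A
begin

abbreviation AG ("\<R>") where "\<R> \<equiv> group_ring A G"
abbreviation grp (\<open>\<delta>\<close>) where "\<delta> \<equiv> grp_elt A G"

lemma group_ring_mem [simp]: "\<lbrakk>x \<in> carrier \<R>; g \<in> carrier G\<rbrakk> \<Longrightarrow> x g \<in> carrier A"
  by (auto simp: group_ring_def)

lemma group_ring_finite: "x \<in> carrier \<R> \<Longrightarrow> finite (support A G x)"
  by (simp add: group_ring_def)

lemma support_sub: "support A G x \<subseteq> carrier G"
  by (auto simp: support_def)

lemma group_ringI:
  assumes "\<And>g. g \<in> carrier G \<Longrightarrow> x g \<in> carrier A" "x \<in> extensional (carrier G)"
    and "support A G x \<subseteq> F" "finite F"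
  shows "x \<in> carrier \<R>"
  using finite_subset[OF assms(3,4)] assms(1,2) by (simp add: group_ring_def PiE_iff del: group_ring_mem)

lemma group_ring_eqI:
  "\<lbrakk>x \<in> carrier \<R>; y \<in> carrier \<R>; \<And>g. g \<in> carrier G \<Longrightarrow> x g = y g\<rbrakk> \<Longrightarrow> x = y"
  by (auto simp: group_ring_def intro: PiE_ext)

lemma group_ring_apply [simp]:
  assumes "g \<in> carrier G"
  shows "(x \<oplus>\<^bsub>\<R>\<^esub> y) g = x g \<oplus>\<^bsub>A\<^esub> y g"
    and "(c \<odot>\<^bsub>\<R>\<^esub> x) g = c \<otimes>\<^bsub>A\<^esub> x g"
    and "\<zero>\<^bsub>\<R>\<^esub> g = \<zero>\<^bsub>A\<^esub>"
    and "\<delta> h g = (if g = h then \<one>\<^bsub>A\<^esub> else \<zero>\<^bsub>A\<^esub>)"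
  using assms by (simp_all add: group_ring_def grp_elt_def)

lemma grp_elt_closed [simp]: "\<delta> g \<in> carrier \<R>"
  by (rule group_ringI[of _ "{g}"]) (auto simp: support_def grp_elt_def split: if_splits)

lemma group_ring_extensional: "x \<in> carrier \<R> \<Longrightarrow> x \<in> extensional (carrier G)"
  by (simp add: group_ring_def PiE_iff del: group_ring_mem)

lemma one_group_ring: "\<one>\<^bsub>\<R>\<^esub> = \<delta> \<one>"
  by (simp add: group_ring_def grp_elt_def)

lemma group_ring_add_closed:
  assumes "x \<in> carrier \<R>" "y \<in> carrier \<R>"
  shows "x \<oplus>\<^bsub>\<R>\<^esub> y \<in> carrier \<R>"
proof (rule group_ringI)
  show "support A G (x \<oplus>\<^bsub>\<R>\<^esub> y) \<subseteq> support A G x \<union> support A G y"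
    by (auto simp: support_def)
qed (use assms in \<open>simp_all add: group_ring_finite, simp add: group_ring_def del: group_ring_mem\<close>)

lemma group_ring_smult_closed:
  assumes "c \<in> carrier A" "x \<in> carrier \<R>"
  shows "c \<odot>\<^bsub>\<R>\<^esub> x \<in> carrier \<R>"
proof (rule group_ringI)
  show "support A G (c \<odot>\<^bsub>\<R>\<^esub> x) \<subseteq> support A G x"
    using assms by (auto simp: support_def)
qed (use assms in \<open>simp_all add: group_ring_finite, simp add: group_ring_def del: group_ring_mem\<close>)

lemma module_group_ring: "module A \<R>"
proof -
  have zero: "\<zero>\<^bsub>\<R>\<^esub> \<in> carrier \<R>"
    by (rule group_ringI[of _ "{}"]) (auto simp: group_ring_def support_def simp del: group_ring_mem)
  show ?thesis
    by (rule module_from_smultI)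
      (auto intro!: group_ring_eqI group_ring_add_closed group_ring_smult_closed zero A.is_cring
        simp: A.a_ac A.m_assoc A.l_distr A.r_distr)
qed

sublocale AG: module A \<R>
  by (rule module_group_ring)

text \<open>The linear map sending each basis element \<open>\<delta> g\<close> to
  \<open>c g\<close>. Left factors of the convolution product and derivations given by cocycles are
  both instances, so closure and linearity are proved once for all of them.\<close>

definition lin_ext :: "('a \<Rightarrow> 'a \<Rightarrow> 'c) \<Rightarrow> ('a \<Rightarrow> 'c) \<Rightarrow> ('a \<Rightarrow> 'c)" where
  "lin_ext c = (\<lambda>x\<in>carrier \<R>. \<lambda>h\<in>carrier G. \<Oplus>\<^bsub>A\<^esub>g\<in>support A G x. x g \<otimes>\<^bsub>A\<^esub> c g h)"

text \<open>Coefficients outside the support contribute zero. The freedom in \<open>F\<close> allows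
  two elements, or an element and its multiple, to be summed over a common index set.\<close>

lemma lin_ext_apply:
  assumes x: "x \<in> carrier \<R>" and F: "finite F" "support A G x \<subseteq> F" "F \<subseteq> carrier G"
    and c: "\<And>g. g \<in> carrier G \<Longrightarrow> c g h \<in> carrier A" and h: "h \<in> carrier G"
  shows "lin_ext c x h = (\<Oplus>\<^bsub>A\<^esub>g\<in>F. x g \<otimes>\<^bsub>A\<^esub> c g h)"
proof -
  have "(\<Oplus>\<^bsub>A\<^esub>g\<in>support A G x. x g \<otimes>\<^bsub>A\<^esub> c g h) = (\<Oplus>\<^bsub>A\<^esub>g\<in>F. x g \<otimes>\<^bsub>A\<^esub> c g h)"
    by (rule A.add.finprod_mono_neutral_cong_left)
      (use assms in \<open>auto simp: support_def\<close>)
  then show ?thesis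
    using x h by (simp add: lin_ext_def)
qed

context
  fixes c assumes c: "\<And>g. g \<in> carrier G \<Longrightarrow> c g \<in> carrier \<R>"
begin

lemma lin_ext_closed:
  assumes x: "x \<in> carrier \<R>"
  shows "lin_ext c x \<in> carrier \<R>"
proof (rule group_ringI)
  let ?F = "\<Union>g\<in>support A G x. support A G (c g)"
  show "finite ?F"
    using x c support_sub group_ring_finite by auto
  show "support A G (lin_ext c x) \<subseteq> ?F"
  proof
    fix h assume h: "h \<in> support A G (lin_ext c x)"
    show "h \<in> ?F"
    proof (rule ccontr)
      assume "h \<notin> ?F"
      then have "c g h = \<zero>\<^bsub>A\<^esub>" if "g \<in> support A G x" for g
        using h that by (auto simp: support_def)
      then have "(\<Oplus>\<^bsub>A\<^esub>g\<in>support A G x. x g \<otimes>\<^bsub>A\<^esub> c g h) = \<zero>\<^bsub>A\<^esub>"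
        using x by (intro A.add.finprod_one_eqI) (auto simp: support_def)
      moreover have "h \<in> carrier G"
        using h by (simp add: support_def)
      ultimately have "lin_ext c x h = \<zero>\<^bsub>A\<^esub>"
        using x by (simp add: lin_ext_def)
      then show False
        using h by (simp add: support_def)
    qed
  qed
qed (use c x in \<open>auto simp: lin_ext_def support_def intro!: A.finsum_closed\<close>)

lemma lin_ext_hom: "lin_ext c \<in> mod_hom A \<R> \<R>"
proof (rule mod_homI)
  fix x y assume xy: "x \<in> carrier \<R>" "y \<in> carrier \<R>"
  let ?F = "support A G x \<union> support A G y"
  have F: "finite ?F" "?F \<subseteq> carrier G"
    using xy support_sub group_ring_finite by auto
  have s: "support A G (x \<oplus>\<^bsub>\<R>\<^esub> y) \<subseteq> ?F"
    by (auto simp: support_def)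
  show "lin_ext c (x \<oplus>\<^bsub>\<R>\<^esub> y) = lin_ext c x \<oplus>\<^bsub>\<R>\<^esub> lin_ext c y"
  proof (rule group_ring_eqI)
    fix h assume h: "h \<in> carrier G"
    have "lin_ext c (x \<oplus>\<^bsub>\<R>\<^esub> y) h = (\<Oplus>\<^bsub>A\<^esub>g\<in>?F. (x \<oplus>\<^bsub>\<R>\<^esub> y) g \<otimes>\<^bsub>A\<^esub> c g h)"
      by (rule lin_ext_apply) (use xy c F s h in auto)
    also have "\<dots> = (\<Oplus>\<^bsub>A\<^esub>g\<in>?F. x g \<otimes>\<^bsub>A\<^esub> c g h \<oplus>\<^bsub>A\<^esub> y g \<otimes>\<^bsub>A\<^esub> c g h)"
      by (rule A.finsum_cong') (use xy c F h in \<open>auto simp: A.l_distr subset_iff\<close>)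
    also have "\<dots> = (\<Oplus>\<^bsub>A\<^esub>g\<in>?F. x g \<otimes>\<^bsub>A\<^esub> c g h) \<oplus>\<^bsub>A\<^esub> (\<Oplus>\<^bsub>A\<^esub>g\<in>?F. y g \<otimes>\<^bsub>A\<^esub> c g h)"
      by (rule A.finsum_addf) (use xy c F h in \<open>auto simp: subset_iff\<close>)
    also have "\<dots> = lin_ext c x h \<oplus>\<^bsub>A\<^esub> lin_ext c y h"
      using xy c F h by (simp add: lin_ext_apply[where F = ?F])
    finally show "lin_ext c (x \<oplus>\<^bsub>\<R>\<^esub> y) h = (lin_ext c x \<oplus>\<^bsub>\<R>\<^esub> lin_ext c y) h"
      using h by simp
  qed (use xy lin_ext_closed in auto)
next
  fix a x assume ax: "a \<in> carrier A" "x \<in> carrier \<R>"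
  let ?F = "support A G x"
  have F: "finite ?F" "?F \<subseteq> carrier G"
    using ax support_sub group_ring_finite by auto
  have s: "support A G (a \<odot>\<^bsub>\<R>\<^esub> x) \<subseteq> ?F"
    using ax by (auto simp: support_def)
  show "lin_ext c (a \<odot>\<^bsub>\<R>\<^esub> x) = a \<odot>\<^bsub>\<R>\<^esub> lin_ext c x"
  proof (rule group_ring_eqI)
    fix h assume h: "h \<in> carrier G"
    have "lin_ext c (a \<odot>\<^bsub>\<R>\<^esub> x) h = (\<Oplus>\<^bsub>A\<^esub>g\<in>?F. (a \<odot>\<^bsub>\<R>\<^esub> x) g \<otimes>\<^bsub>A\<^esub> c g h)"
      by (rule lin_ext_apply) (use ax c F s h in auto)
    also have "\<dots> = (\<Oplus>\<^bsub>A\<^esub>g\<in>?F. a \<otimes>\<^bsub>A\<^esub> (x g \<otimes>\<^bsub>A\<^esub> c g h))"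
      by (rule A.finsum_cong') (use ax c F h in \<open>auto simp: A.m_assoc subset_iff\<close>)
    also have "\<dots> = a \<otimes>\<^bsub>A\<^esub> (\<Oplus>\<^bsub>A\<^esub>g\<in>?F. x g \<otimes>\<^bsub>A\<^esub> c g h)"
      by (rule A.finsum_rdistr[symmetric]) (use ax c F h in \<open>auto simp: subset_iff\<close>)
    also have "\<dots> = a \<otimes>\<^bsub>A\<^esub> lin_ext c x h"
      using ax c F h by (simp add: lin_ext_apply[where F = ?F])
    finally show "lin_ext c (a \<odot>\<^bsub>\<R>\<^esub> x) h = (a \<odot>\<^bsub>\<R>\<^esub> lin_ext c x) h"
      using h by simp
  qed (use ax lin_ext_closed in auto)
qed (rule lin_ext_closed)

lemma lin_ext_grp_elt:
  assumes g: "g \<in> carrier G"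
  shows "lin_ext c (\<delta> g) = c g"
proof (rule group_ring_eqI)
  fix h assume h: "h \<in> carrier G"
  have "lin_ext c (\<delta> g) h = (\<Oplus>\<^bsub>A\<^esub>k\<in>{g}. \<delta> g k \<otimes>\<^bsub>A\<^esub> c k h)"
    by (rule lin_ext_apply) (use g c h in \<open>auto simp: support_def split: if_splits\<close>)
  then show "lin_ext c (\<delta> g) h = c g h"
    using g c h by simp
qed (use g c lin_ext_closed in auto)

end

text \<open>Coefficients are removed one at a time, by induction on a finite set containing the
  support.\<close>

lemma group_ring_induct [consumes 1, case_names zero add]:
  assumes x: "x \<in> carrier \<R>" and "P \<zero>\<^bsub>\<R>\<^esub>"
    and step: "\<And>a g y. \<lbrakk>a \<in> carrier A; g \<in> carrier G; y \<in> carrier \<R>; P y\<rbrakk>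
      \<Longrightarrow> P (a \<odot>\<^bsub>\<R>\<^esub> \<delta> g \<oplus>\<^bsub>\<R>\<^esub> y)"
  shows "P x"
proof -
  have "P x" if "finite F" "x \<in> carrier \<R>" "support A G x \<subseteq> F" for F x
    using that
  proof (induction F arbitrary: x rule: finite_induct)
    case empty
    then have "x = \<zero>\<^bsub>\<R>\<^esub>"
      by (intro group_ring_eqI) (auto simp: support_def)
    then show ?case
      using \<open>P \<zero>\<^bsub>\<R>\<^esub>\<close> by simp
  next
    case (insert g F)
    show ?case
    proof (cases "g \<in> carrier G")
      \<comment> \<open>The finite set may contain points outside the group; these are never in a
        support, so the induction hypothesis already covers \<open>x\<close>.\<close>
      case False
      then show ?thesis
        using insert support_sub[of x] by auto
    next
      case True
      define y where "y = x(g := \<zero>\<^bsub>A\<^esub>)"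
      have s: "support A G y \<subseteq> F"
        using insert.prems by (auto simp: support_def y_def)
      have y: "y \<in> carrier \<R>"
        by (rule group_ringI[OF _ _ s])
          (use insert True group_ring_extensional[of x] in \<open>auto simp: y_def extensional_def\<close>)
      have "x = x g \<odot>\<^bsub>\<R>\<^esub> \<delta> g \<oplus>\<^bsub>\<R>\<^esub> y"
        by (rule group_ring_eqI) (use True insert.prems y in \<open>auto simp: y_def\<close>)
      then show ?thesis
        using step[of "x g" g y] insert.IH[OF y s] insert.prems True y by simp
    qed
  qed
  then show ?thesis
    using x by (metis group_ring_finite order_refl)
qed

text \<open>The group elements span the group ring. This is the device by which associativity, the
  Leibniz rule and equality of derivations are reduced to group elements.\<close>

lemma mod_hom_group_ring_eq:
  assumes N: "module A N" and f: "f \<in> mod_hom A \<R> N" and k: "k \<in> mod_hom A \<R> N"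
    and eq: "\<And>g. g \<in> carrier G \<Longrightarrow> f (\<delta> g) = k (\<delta> g)" and x: "x \<in> carrier \<R>"
  shows "f x = k x"
  using x
proof (induction rule: group_ring_induct)
  case zero
  show ?case
    using mod_hom_zero[OF module_group_ring N] f k by metis
next
  case (add a g y)
  then show ?case
    by (simp add: mod_homD[OF f] mod_homD[OF k] eq)
qed

section \<open>The convolution product\<close>

lemma mult_group_ring_apply:
  assumes "h \<in> carrier G"
  shows "(x \<otimes>\<^bsub>\<R>\<^esub> y) h = (\<Oplus>\<^bsub>A\<^esub>g\<in>support A G x. x g \<otimes>\<^bsub>A\<^esub> y (inv g \<otimes> h))"
  using assms by (simp add: group_ring_def)

lemma translate_closed:
  assumes y: "y \<in> carrier \<R>" and g: "g \<in> carrier G"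
  shows "(\<lambda>h\<in>carrier G. y (inv g \<otimes> h)) \<in> carrier \<R>"
proof (rule group_ringI)
  show "support A G (\<lambda>h\<in>carrier G. y (inv g \<otimes> h)) \<subseteq> (\<lambda>k. g \<otimes> k) ` support A G y"
  proof
    fix h assume "h \<in> support A G (\<lambda>h\<in>carrier G. y (inv g \<otimes> h))"
    then have "h = g \<otimes> (inv g \<otimes> h)" "inv g \<otimes> h \<in> support A G y"
      using g by (auto simp: support_def m_assoc[symmetric])
    then show "h \<in> (\<lambda>k. g \<otimes> k) ` support A G y"
      by (rule image_eqI)
  qed
qed (use y g in \<open>auto simp: group_ring_finite\<close>)

text \<open>Multiplication by \<open>\<delta> g\<close> on the left translates \<open>y\<close>, and
  the product is linear in the left factor; hence linearity in \<open>x\<close> comes from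
  \<open>lin_ext_hom\<close>.\<close>

lemma mult_eq_lin_ext:
  assumes x: "x \<in> carrier \<R>"
  shows "x \<otimes>\<^bsub>\<R>\<^esub> y = lin_ext (\<lambda>g. \<lambda>h\<in>carrier G. y (inv g \<otimes> h)) x"
  using x by (auto simp: lin_ext_def group_ring_def)

lemma group_ring_mult_closed: "\<lbrakk>x \<in> carrier \<R>; y \<in> carrier \<R>\<rbrakk> \<Longrightarrow> x \<otimes>\<^bsub>\<R>\<^esub> y \<in> carrier \<R>"
  by (simp add: mult_eq_lin_ext lin_ext_closed translate_closed)

lemma mult_left_hom:
  assumes "y \<in> carrier \<R>"
  shows "(\<lambda>x. x \<otimes>\<^bsub>\<R>\<^esub> y) \<in> mod_hom A \<R> \<R>"
proof -
  have "lin_ext (\<lambda>g. \<lambda>h\<in>carrier G. y (inv g \<otimes> h)) \<in> mod_hom A \<R> \<R>"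
    by (rule lin_ext_hom) (rule translate_closed[OF assms])
  from mod_homD[OF this] show ?thesis
    by (intro mod_homI) (simp_all add: mult_eq_lin_ext)
qed

text \<open>The product sums over the support of the left factor, which stays fixed here, so the
  sums can be compared term by term.\<close>

lemma mult_right_hom:
  assumes x: "x \<in> carrier \<R>"
  shows "(\<lambda>y. x \<otimes>\<^bsub>\<R>\<^esub> y) \<in> mod_hom A \<R> \<R>"
proof (rule mod_homI)
  have F: "g \<in> carrier G" if "g \<in> support A G x" for g
    using that support_sub by auto
  fix y assume y: "y \<in> carrier \<R>"
  show "x \<otimes>\<^bsub>\<R>\<^esub> y \<in> carrier \<R>"
    using x y by (rule group_ring_mult_closed)
  {
    fix z assume z: "z \<in> carrier \<R>"
    show "x \<otimes>\<^bsub>\<R>\<^esub> (y \<oplus>\<^bsub>\<R>\<^esub> z) = x \<otimes>\<^bsub>\<R>\<^esub> y \<oplus>\<^bsub>\<R>\<^esub> x \<otimes>\<^bsub>\<R>\<^esub> z"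
    proof (rule group_ring_eqI)
      fix h assume h: "h \<in> carrier G"
      have "(x \<otimes>\<^bsub>\<R>\<^esub> (y \<oplus>\<^bsub>\<R>\<^esub> z)) h =
        (\<Oplus>\<^bsub>A\<^esub>g\<in>support A G x. x g \<otimes>\<^bsub>A\<^esub> y (inv g \<otimes> h) \<oplus>\<^bsub>A\<^esub> x g \<otimes>\<^bsub>A\<^esub> z (inv g \<otimes> h))"
        unfolding mult_group_ring_apply[OF h]
        by (rule A.finsum_cong') (use x y z h F in \<open>auto simp: A.r_distr\<close>)
      then show "(x \<otimes>\<^bsub>\<R>\<^esub> (y \<oplus>\<^bsub>\<R>\<^esub> z)) h = (x \<otimes>\<^bsub>\<R>\<^esub> y \<oplus>\<^bsub>\<R>\<^esub> x \<otimes>\<^bsub>\<R>\<^esub> z) h"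
        using x y z h F by (simp add: mult_group_ring_apply A.finsum_addf Pi_iff)
    qed (use x y z in \<open>simp_all add: group_ring_mult_closed\<close>)
  next
    fix a assume a: "a \<in> carrier A"
    show "x \<otimes>\<^bsub>\<R>\<^esub> (a \<odot>\<^bsub>\<R>\<^esub> y) = a \<odot>\<^bsub>\<R>\<^esub> (x \<otimes>\<^bsub>\<R>\<^esub> y)"
    proof (rule group_ring_eqI)
      fix h assume h: "h \<in> carrier G"
      have "(x \<otimes>\<^bsub>\<R>\<^esub> (a \<odot>\<^bsub>\<R>\<^esub> y)) h = (\<Oplus>\<^bsub>A\<^esub>g\<in>support A G x. a \<otimes>\<^bsub>A\<^esub> (x g \<otimes>\<^bsub>A\<^esub> y (inv g \<otimes> h)))"
        unfolding mult_group_ring_apply[OF h]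
        by (rule A.finsum_cong') (use x y a h F in \<open>auto simp: A.m_lcomm\<close>)
      then show "(x \<otimes>\<^bsub>\<R>\<^esub> (a \<odot>\<^bsub>\<R>\<^esub> y)) h = (a \<odot>\<^bsub>\<R>\<^esub> (x \<otimes>\<^bsub>\<R>\<^esub> y)) h"
        using x y a h F by (simp add: mult_group_ring_apply A.finsum_rdistr Pi_iff group_ring_finite)
    qed (use x y a in \<open>simp_all add: group_ring_mult_closed\<close>)
  }
qed

lemma grp_elt_mult_apply:
  assumes "g \<in> carrier G" "y \<in> carrier \<R>" "h \<in> carrier G"
  shows "(\<delta> g \<otimes>\<^bsub>\<R>\<^esub> y) h = y (inv g \<otimes> h)"
  using assms by (simp add: mult_eq_lin_ext lin_ext_grp_elt translate_closed)

text \<open>Only the factorization h = (h g^-1) g contributes to the sum; if h g^-1 lies outside the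
  support, both sides are zero.\<close>

lemma mult_grp_elt_apply:
  assumes x: "x \<in> carrier \<R>" and g: "g \<in> carrier G" and h: "h \<in> carrier G"
  shows "(x \<otimes>\<^bsub>\<R>\<^esub> \<delta> g) h = x (h \<otimes> inv g)"
proof -
  have eq: "inv k \<otimes> h = g \<longleftrightarrow> k = h \<otimes> inv g" if "k \<in> carrier G" for k
    using that g h by (metis inv_solve_left inv_solve_right inv_closed)
  have "(x \<otimes>\<^bsub>\<R>\<^esub> \<delta> g) h = (\<Oplus>\<^bsub>A\<^esub>k\<in>{h \<otimes> inv g}. x k)"
    unfolding mult_group_ring_apply[OF h]
    by (rule A.add.finprod_mono_neutral_cong)
      (use x g h eq in \<open>auto simp: group_ring_finite, auto simp: support_def\<close>)
  then show ?thesis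
    using x g h by simp
qed

lemma grp_elt_mult:
  assumes "g \<in> carrier G" "h \<in> carrier G"
  shows "\<delta> g \<otimes>\<^bsub>\<R>\<^esub> \<delta> h = \<delta> (g \<otimes> h)"
proof (rule group_ring_eqI)
  fix k assume "k \<in> carrier G"
  with assms show "(\<delta> g \<otimes>\<^bsub>\<R>\<^esub> \<delta> h) k = \<delta> (g \<otimes> h) k"
    by (simp add: grp_elt_mult_apply inv_solve_left')
qed (use assms in \<open>simp_all add: group_ring_mult_closed\<close>)

text \<open>Both sides are linear in each factor. It suffices to take group elements for
  \<open>x\<close> and \<open>y\<close>; then left multiplications are translations, which compose
  correctly on an arbitrary \<open>z\<close>.\<close>

lemma mult_assoc_group_ring:
  assumes x: "x \<in> carrier \<R>" and y: "y \<in> carrier \<R>" and z: "z \<in> carrier \<R>"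
  shows "x \<otimes>\<^bsub>\<R>\<^esub> y \<otimes>\<^bsub>\<R>\<^esub> z = x \<otimes>\<^bsub>\<R>\<^esub> (y \<otimes>\<^bsub>\<R>\<^esub> z)"
proof -
  note [simp] = group_ring_mult_closed
  have "\<delta> g \<otimes>\<^bsub>\<R>\<^esub> y \<otimes>\<^bsub>\<R>\<^esub> z = \<delta> g \<otimes>\<^bsub>\<R>\<^esub> (y \<otimes>\<^bsub>\<R>\<^esub> z)" if g: "g \<in> carrier G" for g
  proof (rule mod_hom_group_ring_eq[OF module_group_ring _ _ _ y])
    show "(\<lambda>y. \<delta> g \<otimes>\<^bsub>\<R>\<^esub> y \<otimes>\<^bsub>\<R>\<^esub> z) \<in> mod_hom A \<R> \<R>"
      by (rule mod_hom_compose[OF mult_right_hom mult_left_hom]) (use z in auto)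
    show "(\<lambda>y. \<delta> g \<otimes>\<^bsub>\<R>\<^esub> (y \<otimes>\<^bsub>\<R>\<^esub> z)) \<in> mod_hom A \<R> \<R>"
      by (rule mod_hom_compose[OF mult_left_hom mult_right_hom]) (use z in auto)
    show "\<delta> g \<otimes>\<^bsub>\<R>\<^esub> \<delta> k \<otimes>\<^bsub>\<R>\<^esub> z = \<delta> g \<otimes>\<^bsub>\<R>\<^esub> (\<delta> k \<otimes>\<^bsub>\<R>\<^esub> z)" if "k \<in> carrier G" for k
      by (rule group_ring_eqI)
        (use g z that in \<open>simp_all add: grp_elt_mult grp_elt_mult_apply inv_mult_group m_assoc\<close>)
  qed
  moreover have "(\<lambda>x. x \<otimes>\<^bsub>\<R>\<^esub> y \<otimes>\<^bsub>\<R>\<^esub> z) \<in> mod_hom A \<R> \<R>"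
    by (rule mod_hom_compose[OF mult_left_hom mult_left_hom]) (use y z in auto)
  moreover have "(\<lambda>x. x \<otimes>\<^bsub>\<R>\<^esub> (y \<otimes>\<^bsub>\<R>\<^esub> z)) \<in> mod_hom A \<R> \<R>"
    by (rule mult_left_hom) (use y z in auto)
  ultimately show ?thesis
    using mod_hom_group_ring_eq[OF module_group_ring _ _ _ x] by blast
qed

lemma ring_group_ring: "ring \<R>"
proof (rule ringI)
  show "monoid \<R>"
    by (rule monoidI)
      (auto intro!: group_ring_eqI simp: group_ring_mult_closed mult_assoc_group_ring
        one_group_ring grp_elt_mult_apply mult_grp_elt_apply)
qed (auto simp: AG.abelian_group_axioms mod_homD(2)[OF mult_left_hom] mod_homD(2)[OF mult_right_hom])

lemma assoc_algebra_group_ring: "assoc_algebra A \<R>"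
proof -
  interpret ring \<R> by (rule ring_group_ring)
  show ?thesis
    by unfold_locales (simp_all add: mod_homD(3)[OF mult_left_hom] mod_homD(3)[OF mult_right_hom])
qed

text \<open>The additive inverse in the group ring is given only by its defining property, so its
  values are identified through uniqueness of inverses in \<open>A\<close>.\<close>

lemma group_ring_a_minus_apply:
  assumes "x \<in> carrier \<R>" "y \<in> carrier \<R>" "g \<in> carrier G"
  shows "(x \<ominus>\<^bsub>\<R>\<^esub> y) g = x g \<ominus>\<^bsub>A\<^esub> y g"
proof -
  have "(\<ominus>\<^bsub>\<R>\<^esub> y) g \<oplus>\<^bsub>A\<^esub> y g = (\<ominus>\<^bsub>\<R>\<^esub> y \<oplus>\<^bsub>\<R>\<^esub> y) g"
    using assms by simp
  then have "(\<ominus>\<^bsub>\<R>\<^esub> y) g = \<ominus>\<^bsub>A\<^esub> y g"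
    using assms by (intro A.minus_equality[symmetric]) (simp_all add: AG.M.l_neg)
  then show ?thesis
    using assms by (simp add: AG.M.minus_eq A.minus_eq)
qed

end

section \<open>Derivations of the group ring as cocycles\<close>

context group_algebra
begin

sublocale Der: module A "Der A \<R>"
  using assoc_algebra.module_Der[OF assoc_algebra_group_ring] .

text \<open>\<open>g \<mapsto> chi d g\<close> is the 1-cocycle \<open>g \<mapsto> d(g) g\<inverse>\<close> for the conjugation action of \<open>G\<close> on \<open>A[G]\<close>.\<close>

definition chi :: "(('a \<Rightarrow> 'c) \<Rightarrow> 'a \<Rightarrow> 'c) \<Rightarrow> 'a \<Rightarrow> 'a \<Rightarrow> 'c" where
  "chi d g k = d (\<delta> g) (k \<otimes> g)"

lemma chi_closed [simp]:
  "\<lbrakk>d \<in> carrier (Der A \<R>); g \<in> carrier G; k \<in> carrier G\<rbrakk> \<Longrightarrow> chi d g k \<in> carrier A"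
  by (simp add: chi_def Der_closed)

text \<open>The Leibniz rule for the product of \<open>\<delta> g\<close> and
  \<open>\<delta> h\<close>, read off at the point k g h. Right translation by h takes the first
  term back to k g; left translation by g takes the second to g^-1 k g h, which produces the
  conjugated argument.\<close>

lemma chi_cocycle:
  assumes d: "d \<in> carrier (Der A \<R>)" and g: "g \<in> carrier G" and h: "h \<in> carrier G"
    and k: "k \<in> carrier G"
  shows "chi d (g \<otimes> h) k = chi d g k \<oplus>\<^bsub>A\<^esub> chi d h (inv g \<otimes> k \<otimes> g)"
proof -
  have "chi d (g \<otimes> h) k = d (\<delta> g \<otimes>\<^bsub>\<R>\<^esub> \<delta> h) (k \<otimes> g \<otimes> h)"
    using g h k by (simp add: chi_def grp_elt_mult m_assoc)
  also have "\<dots> = (d (\<delta> g) \<otimes>\<^bsub>\<R>\<^esub> \<delta> h \<oplus>\<^bsub>\<R>\<^esub> \<delta> g \<otimes>\<^bsub>\<R>\<^esub> d (\<delta> h)) (k \<otimes> g \<otimes> h)"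
    by (simp add: DerD(3)[OF d])
  also have "\<dots> = chi d g k \<oplus>\<^bsub>A\<^esub> chi d h (inv g \<otimes> k \<otimes> g)"
    using g h k by (simp add: chi_def Der_closed[OF d] grp_elt_mult_apply mult_grp_elt_apply m_assoc)
  finally show ?thesis .
qed

lemma chi_one:
  assumes "d \<in> carrier (Der A \<R>)" "k \<in> carrier G"
  shows "chi d \<one> k = \<zero>\<^bsub>A\<^esub>"
  using chi_cocycle[of d \<one> \<one> k] assms by (simp add: A.add.r_cancel_one')

lemma chi_inv:
  assumes d: "d \<in> carrier (Der A \<R>)" and g: "g \<in> carrier G" and k: "k \<in> carrier G"
  shows "chi d (inv g) k = \<ominus>\<^bsub>A\<^esub> chi d g (g \<otimes> k \<otimes> inv g)"
  using chi_cocycle[OF d, of "inv g" g k] chi_one[OF d k] d g k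
  by (simp add: A.minus_equality)

lemma finite_chi:
  assumes d: "d \<in> carrier (Der A \<R>)" and g: "g \<in> carrier G"
  shows "finite {k \<in> carrier G. chi d g k \<noteq> \<zero>\<^bsub>A\<^esub>}"
proof (rule finite_subset)
  show "{k \<in> carrier G. chi d g k \<noteq> \<zero>\<^bsub>A\<^esub>} \<subseteq> (\<lambda>h. h \<otimes> inv g) ` support A G (d (\<delta> g))"
  proof
    fix k assume "k \<in> {k \<in> carrier G. chi d g k \<noteq> \<zero>\<^bsub>A\<^esub>}"
    then have "k = (k \<otimes> g) \<otimes> inv g" "k \<otimes> g \<in> support A G (d (\<delta> g))"
      using g by (auto simp: support_def chi_def m_assoc)
    then show "k \<in> (\<lambda>h. h \<otimes> inv g) ` support A G (d (\<delta> g))"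
      by (rule image_eqI)
  qed
  show "finite ((\<lambda>h. h \<otimes> inv g) ` support A G (d (\<delta> g)))"
    using d by (simp add: Der_closed group_ring_finite)
qed

text \<open>Since h = (h g^-1) g, the values of \<open>chi d g\<close> are all the coefficients of d
  at \<open>\<delta> g\<close>, and these determine d by linearity.\<close>

lemma Der_eqI:
  assumes d: "d \<in> carrier (Der A \<R>)" and e: "e \<in> carrier (Der A \<R>)"
    and eq: "\<And>g k. \<lbrakk>g \<in> carrier G; k \<in> carrier G\<rbrakk> \<Longrightarrow> chi d g k = chi e g k"
  shows "d = e"
proof (rule extensionalityI[OF DerD(2)[OF d] DerD(2)[OF e]])
  have "d (\<delta> g) = e (\<delta> g)" if g: "g \<in> carrier G" for g
  proof (rule group_ring_eqI)
    fix h assume "h \<in> carrier G"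
    then show "d (\<delta> g) h = e (\<delta> g) h"
      using eq[of g "h \<otimes> inv g"] g by (simp add: chi_def m_assoc)
  qed (simp_all add: Der_closed[OF d] Der_closed[OF e])
  then show "d x = e x" if "x \<in> carrier \<R>" for x
    using mod_hom_group_ring_eq[OF module_group_ring DerD(1)[OF d] DerD(1)[OF e] _ that] by blast
qed

text \<open>Both sides of the Leibniz rule are linear in each argument; the second argument is
  extended from group elements to the whole ring before the first.\<close>

lemma group_ring_DerI:
  assumes d: "d \<in> mod_hom A \<R> \<R>" and ext: "d \<in> extensional (carrier \<R>)"
    and gen: "\<And>g h. \<lbrakk>g \<in> carrier G; h \<in> carrier G\<rbrakk>
      \<Longrightarrow> d (\<delta> g \<otimes>\<^bsub>\<R>\<^esub> \<delta> h) = d (\<delta> g) \<otimes>\<^bsub>\<R>\<^esub> \<delta> h \<oplus>\<^bsub>\<R>\<^esub> \<delta> g \<otimes>\<^bsub>\<R>\<^esub> d (\<delta> h)"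
  shows "d \<in> carrier (Der A \<R>)"
proof (rule DerI[OF d ext])
  note m = module_group_ring
  note dl = mod_homD(1)[OF d]
  have gen': "d (\<delta> g \<otimes>\<^bsub>\<R>\<^esub> y) = d (\<delta> g) \<otimes>\<^bsub>\<R>\<^esub> y \<oplus>\<^bsub>\<R>\<^esub> \<delta> g \<otimes>\<^bsub>\<R>\<^esub> d y"
    if g: "g \<in> carrier G" and y: "y \<in> carrier \<R>" for g y
  proof -
    have 1: "(\<lambda>y. d (\<delta> g \<otimes>\<^bsub>\<R>\<^esub> y)) \<in> mod_hom A \<R> \<R>"
      by (rule mod_hom_compose[OF mult_right_hom d]) simp
    have 2: "(\<lambda>y. d (\<delta> g) \<otimes>\<^bsub>\<R>\<^esub> y \<oplus>\<^bsub>\<R>\<^esub> \<delta> g \<otimes>\<^bsub>\<R>\<^esub> d y) \<in> mod_hom A \<R> \<R>"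
      by (rule mod_hom_add[OF m mult_right_hom mod_hom_compose[OF d mult_right_hom]]) (simp_all add: dl)
    show ?thesis
      by (rule mod_hom_group_ring_eq[OF m 1 2 _ y]) (rule gen[OF g])
  qed
  fix x y assume x: "x \<in> carrier \<R>" and y: "y \<in> carrier \<R>"
  have 1: "(\<lambda>x. d (x \<otimes>\<^bsub>\<R>\<^esub> y)) \<in> mod_hom A \<R> \<R>"
    by (rule mod_hom_compose[OF mult_left_hom[OF y] d])
  have 2: "(\<lambda>x. d x \<otimes>\<^bsub>\<R>\<^esub> y \<oplus>\<^bsub>\<R>\<^esub> x \<otimes>\<^bsub>\<R>\<^esub> d y) \<in> mod_hom A \<R> \<R>"
    by (rule mod_hom_add[OF m mod_hom_compose[OF d mult_left_hom[OF y]] mult_left_hom[OF dl[OF y]]])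
  show "d (x \<otimes>\<^bsub>\<R>\<^esub> y) = d x \<otimes>\<^bsub>\<R>\<^esub> y \<oplus>\<^bsub>\<R>\<^esub> x \<otimes>\<^bsub>\<R>\<^esub> d y"
    by (rule mod_hom_group_ring_eq[OF m 1 2 _ x]) (rule gen'[OF _ y])
qed

text \<open>The inverse of \<open>chi\<close>: the substitution h = k g turns the value of the
  cocycle at k into the coefficient at h of the image of \<open>\<delta> g\<close>.\<close>

definition der_of :: "('a \<Rightarrow> 'a \<Rightarrow> 'c) \<Rightarrow> ('a \<Rightarrow> 'c) \<Rightarrow> 'a \<Rightarrow> 'c" where
  "der_of c = lin_ext (\<lambda>g. \<lambda>h\<in>carrier G. c g (h \<otimes> inv g))"

context
  fixes c
  assumes c_closed: "\<And>g k. \<lbrakk>g \<in> carrier G; k \<in> carrier G\<rbrakk> \<Longrightarrow> c g k \<in> carrier A"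
    and c_finite: "\<And>g. g \<in> carrier G \<Longrightarrow> finite {k \<in> carrier G. c g k \<noteq> \<zero>\<^bsub>A\<^esub>}"
    and c_cocycle: "\<And>g h k. \<lbrakk>g \<in> carrier G; h \<in> carrier G; k \<in> carrier G\<rbrakk>
      \<Longrightarrow> c (g \<otimes> h) k = c g k \<oplus>\<^bsub>A\<^esub> c h (inv g \<otimes> k \<otimes> g)"
begin

lemma der_of_coeff_closed:
  assumes g: "g \<in> carrier G"
  shows "(\<lambda>h\<in>carrier G. c g (h \<otimes> inv g)) \<in> carrier \<R>"
proof (rule group_ringI)
  let ?x = "\<lambda>h\<in>carrier G. c g (h \<otimes> inv g)"
  show "support A G ?x \<subseteq> (\<lambda>k. k \<otimes> g) ` {k \<in> carrier G. c g k \<noteq> \<zero>\<^bsub>A\<^esub>}"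
  proof
    fix h assume "h \<in> support A G ?x"
    then have "h = (h \<otimes> inv g) \<otimes> g" "h \<otimes> inv g \<in> {k \<in> carrier G. c g k \<noteq> \<zero>\<^bsub>A\<^esub>}"
      using g by (auto simp: support_def m_assoc)
    then show "h \<in> (\<lambda>k. k \<otimes> g) ` {k \<in> carrier G. c g k \<noteq> \<zero>\<^bsub>A\<^esub>}"
      by (rule image_eqI)
  qed
qed (use g c_closed c_finite in auto)

lemma der_of_grp_elt:
  "g \<in> carrier G \<Longrightarrow> der_of c (\<delta> g) = (\<lambda>h\<in>carrier G. c g (h \<otimes> inv g))"
  unfolding der_of_def by (rule lin_ext_grp_elt) (rule der_of_coeff_closed)

lemma chi_der_of: "\<lbrakk>g \<in> carrier G; k \<in> carrier G\<rbrakk> \<Longrightarrow> chi (der_of c) g k = c g k"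
  by (simp add: chi_def der_of_grp_elt m_assoc)

lemma der_of_in_Der: "der_of c \<in> carrier (Der A \<R>)"
proof (rule group_ring_DerI)
  show hom: "der_of c \<in> mod_hom A \<R> \<R>"
    unfolding der_of_def by (rule lin_ext_hom) (rule der_of_coeff_closed)
  show "der_of c \<in> extensional (carrier \<R>)"
    by (simp add: der_of_def lin_ext_def)
  note [simp] = mod_homD(1)[OF hom] group_ring_mult_closed
  fix g h assume g: "g \<in> carrier G" and h: "h \<in> carrier G"
  show "der_of c (\<delta> g \<otimes>\<^bsub>\<R>\<^esub> \<delta> h) =
    der_of c (\<delta> g) \<otimes>\<^bsub>\<R>\<^esub> \<delta> h \<oplus>\<^bsub>\<R>\<^esub> \<delta> g \<otimes>\<^bsub>\<R>\<^esub> der_of c (\<delta> h)"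
  proof (rule group_ring_eqI)
    fix k assume k: "k \<in> carrier G"
    have "der_of c (\<delta> g \<otimes>\<^bsub>\<R>\<^esub> \<delta> h) k = c (g \<otimes> h) (k \<otimes> inv h \<otimes> inv g)"
      using g h k by (simp add: grp_elt_mult der_of_grp_elt inv_mult_group m_assoc)
    also have "\<dots> = c g (k \<otimes> inv h \<otimes> inv g) \<oplus>\<^bsub>A\<^esub> c h (inv g \<otimes> k \<otimes> inv h)"
      using g h k by (simp add: c_cocycle m_assoc)
    also have "\<dots> = (der_of c (\<delta> g) \<otimes>\<^bsub>\<R>\<^esub> \<delta> h \<oplus>\<^bsub>\<R>\<^esub> \<delta> g \<otimes>\<^bsub>\<R>\<^esub> der_of c (\<delta> h)) k"
      using g h k by (simp add: mult_grp_elt_apply grp_elt_mult_apply) (simp add: der_of_grp_elt m_assoc)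
    finally show "der_of c (\<delta> g \<otimes>\<^bsub>\<R>\<^esub> \<delta> h) k =
      (der_of c (\<delta> g) \<otimes>\<^bsub>\<R>\<^esub> \<delta> h \<oplus>\<^bsub>\<R>\<^esub> \<delta> g \<otimes>\<^bsub>\<R>\<^esub> der_of c (\<delta> h)) k" .
  qed simp_all
qed

end

section \<open>Inner derivations as coboundaries\<close>

lemma chi_add: "\<lbrakk>g \<in> carrier G; k \<in> carrier G\<rbrakk>
    \<Longrightarrow> chi (d \<oplus>\<^bsub>Der A \<R>\<^esub> e) g k = chi d g k \<oplus>\<^bsub>A\<^esub> chi e g k"
  and chi_smult: "\<lbrakk>g \<in> carrier G; k \<in> carrier G\<rbrakk>
    \<Longrightarrow> chi (a \<odot>\<^bsub>Der A \<R>\<^esub> d) g k = a \<otimes>\<^bsub>A\<^esub> chi d g k"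
  and chi_zero: "\<lbrakk>g \<in> carrier G; k \<in> carrier G\<rbrakk> \<Longrightarrow> chi \<zero>\<^bsub>Der A \<R>\<^esub> g k = \<zero>\<^bsub>A\<^esub>"
  by (simp_all add: chi_def)

lemma chi_finsum:
  assumes "finite F" "f \<in> F \<rightarrow> carrier (Der A \<R>)" and g: "g \<in> carrier G" and k: "k \<in> carrier G"
  shows "chi (\<Oplus>\<^bsub>Der A \<R>\<^esub>a\<in>F. f a) g k = (\<Oplus>\<^bsub>A\<^esub>a\<in>F. chi (f a) g k)"
  using assms(1,2)
proof (induction F rule: finite_induct)
  case (insert a F)
  then show ?case
    using g k by (simp add: chi_add Pi_iff)
qed (use g k in \<open>simp add: chi_zero\<close>)

lemma ad_grp_elt_in_Der: "ad \<R> (\<delta> a) \<in> carrier (Der A \<R>)"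
  by (rule assoc_algebra.ad_in_Der[OF assoc_algebra_group_ring]) simp

text \<open>The products in the commutator are concentrated at a g and g a; at the point k g these
  conditions read k = a and g^-1 k g = a.\<close>

lemma chi_ad:
  assumes a: "a \<in> carrier G" and g: "g \<in> carrier G" and k: "k \<in> carrier G"
  shows "chi (ad \<R> (\<delta> a)) g k = \<delta> a k \<ominus>\<^bsub>A\<^esub> \<delta> a (inv g \<otimes> k \<otimes> g)"
proof -
  have "chi (ad \<R> (\<delta> a)) g k =
      (\<delta> a \<otimes>\<^bsub>\<R>\<^esub> \<delta> g) (k \<otimes> g) \<ominus>\<^bsub>A\<^esub> (\<delta> g \<otimes>\<^bsub>\<R>\<^esub> \<delta> a) (k \<otimes> g)"
    unfolding chi_def ad_def
    using g k by (simp add: group_ring_mult_closed group_ring_a_minus_apply del: group_ring_apply)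
  then show ?thesis
    using assms mult_grp_elt_apply[of "\<delta> a" g "k \<otimes> g"] grp_elt_mult_apply[of g "\<delta> a" "k \<otimes> g"]
    by (simp add: m_assoc del: group_ring_apply)
qed

lemma finsum_grp_elt:
  assumes F: "finite F" "F \<subseteq> carrier G" "C \<in> F \<rightarrow> carrier A" and k: "k \<in> carrier G"
  shows "(\<Oplus>\<^bsub>A\<^esub>a\<in>F. C a \<otimes>\<^bsub>A\<^esub> \<delta> a k) = (if k \<in> F then C k else \<zero>\<^bsub>A\<^esub>)"
proof (cases "k \<in> F")
  case True
  have "(\<Oplus>\<^bsub>A\<^esub>a\<in>F. C a \<otimes>\<^bsub>A\<^esub> \<delta> a k) = (\<Oplus>\<^bsub>A\<^esub>a\<in>F. if k = a then C a else \<zero>\<^bsub>A\<^esub>)"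
    by (rule A.finsum_cong') (use F k in \<open>auto simp: Pi_iff\<close>)
  then show ?thesis
    using A.finsum_singleton[OF True F(1,3)] True by simp
next
  case False
  then have "(\<Oplus>\<^bsub>A\<^esub>a\<in>F. C a \<otimes>\<^bsub>A\<^esub> \<delta> a k) = \<zero>\<^bsub>A\<^esub>"
    by (intro A.add.finprod_one_eqI) (use F k in \<open>auto simp: Pi_iff\<close>)
  with False show ?thesis by simp
qed

text \<open>Conjugation by g may carry a point of \<open>F\<close> out of \<open>F\<close>, where
  \<open>C\<close> is not controlled. The extension by zero \<open>C'\<close> makes the coboundary
  formula meaningful at every point.\<close>

lemma chi_inner:
  assumes F: "finite F" "F \<subseteq> carrier G" "C \<in> F \<rightarrow> carrier A"
    and g: "g \<in> carrier G" and k: "k \<in> carrier G"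
  defines "C' \<equiv> \<lambda>k. if k \<in> F then C k else \<zero>\<^bsub>A\<^esub>"
  shows "chi (\<Oplus>\<^bsub>Der A \<R>\<^esub>a\<in>F. C a \<odot>\<^bsub>Der A \<R>\<^esub> ad \<R> (\<delta> a)) g k = C' k \<ominus>\<^bsub>A\<^esub> C' (inv g \<otimes> k \<otimes> g)"
proof -
  let ?k = "inv g \<otimes> k \<otimes> g"
  have C: "C a \<in> carrier A" "a \<in> carrier G" if "a \<in> F" for a
    using that F by auto
  have "chi (\<Oplus>\<^bsub>Der A \<R>\<^esub>a\<in>F. C a \<odot>\<^bsub>Der A \<R>\<^esub> ad \<R> (\<delta> a)) g k =
      (\<Oplus>\<^bsub>A\<^esub>a\<in>F. chi (C a \<odot>\<^bsub>Der A \<R>\<^esub> ad \<R> (\<delta> a)) g k)"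
    by (rule chi_finsum) (use F g k C ad_grp_elt_in_Der in auto)
  also have "\<dots> = (\<Oplus>\<^bsub>A\<^esub>a\<in>F. C a \<otimes>\<^bsub>A\<^esub> \<delta> a k \<oplus>\<^bsub>A\<^esub> (\<ominus>\<^bsub>A\<^esub> C a) \<otimes>\<^bsub>A\<^esub> \<delta> a ?k)"
    by (rule A.finsum_cong')
      (use g k C in \<open>auto simp: chi_smult chi_ad A.minus_eq A.r_distr A.l_minus A.r_minus\<close>)
  also have "\<dots> = (\<Oplus>\<^bsub>A\<^esub>a\<in>F. C a \<otimes>\<^bsub>A\<^esub> \<delta> a k) \<oplus>\<^bsub>A\<^esub> (\<Oplus>\<^bsub>A\<^esub>a\<in>F. (\<ominus>\<^bsub>A\<^esub> C a) \<otimes>\<^bsub>A\<^esub> \<delta> a ?k)"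
    by (rule A.finsum_addf) (use g k C in auto)
  also have "\<dots> = C' k \<ominus>\<^bsub>A\<^esub> C' ?k"
    using finsum_grp_elt[OF F k] finsum_grp_elt[OF F(1,2), of "\<lambda>a. \<ominus>\<^bsub>A\<^esub> C a" ?k] g k C
    by (auto simp: C'_def A.minus_eq Pi_iff)
  finally show ?thesis .
qed

text \<open>A finite combination of the \<open>ad\<close> of group elements is the same datum as a
  finitely supported function \<open>C\<close>: extend the coefficients by zero, or conversely take
  the support of \<open>C\<close> as index set. Later arguments can then work with coboundaries
  alone, without sums of derivations.\<close>

lemma Inn_carrier_iff:
  "d \<in> carrier (Inn A G) \<longleftrightarrow> d \<in> carrier (Der A \<R>) \<and>
    (\<exists>C \<in> carrier G \<rightarrow> carrier A. finite {k \<in> carrier G. C k \<noteq> \<zero>\<^bsub>A\<^esub>} \<and>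
      (\<forall>g \<in> carrier G. \<forall>k \<in> carrier G. chi d g k = C k \<ominus>\<^bsub>A\<^esub> C (inv g \<otimes> k \<otimes> g)))"
  (is "_ \<longleftrightarrow> _ \<and> (\<exists>C \<in> _. ?P d C)")
proof
  have closed: "(\<Oplus>\<^bsub>Der A \<R>\<^esub>a\<in>F. C a \<odot>\<^bsub>Der A \<R>\<^esub> ad \<R> (\<delta> a)) \<in> carrier (Der A \<R>)"
    if "C \<in> F \<rightarrow> carrier A" for F C
    using that ad_grp_elt_in_Der by (intro Der.M.finsum_closed) auto
  {
    assume "d \<in> carrier (Inn A G)"
    then obtain F C where F: "finite F" "F \<subseteq> carrier G" "C \<in> F \<rightarrow> carrier A"
      and d: "d = (\<Oplus>\<^bsub>Der A \<R>\<^esub>a\<in>F. C a \<odot>\<^bsub>Der A \<R>\<^esub> ad \<R> (\<delta> a))"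
      by (auto simp: Inn_def)
    let ?C = "\<lambda>k. if k \<in> F then C k else \<zero>\<^bsub>A\<^esub>"
    have "?P d ?C"
      using chi_inner[OF F] F(1) unfolding d by (auto intro: finite_subset[OF _ F(1)])
    then show "d \<in> carrier (Der A \<R>) \<and> (\<exists>C \<in> carrier G \<rightarrow> carrier A. ?P d C)"
      using closed[OF F(3)] F(3) unfolding d by (intro conjI bexI[of _ ?C]) auto
  next
    assume "d \<in> carrier (Der A \<R>) \<and> (\<exists>C \<in> carrier G \<rightarrow> carrier A. ?P d C)"
    then obtain C where d: "d \<in> carrier (Der A \<R>)" and C: "C \<in> carrier G \<rightarrow> carrier A"
      and fin: "finite {k \<in> carrier G. C k \<noteq> \<zero>\<^bsub>A\<^esub>}"
      and chi: "\<And>g k. \<lbrakk>g \<in> carrier G; k \<in> carrier G\<rbrakk> \<Longrightarrow> chi d g k = C k \<ominus>\<^bsub>A\<^esub> C (inv g \<otimes> k \<otimes> g)"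
      by blast
    let ?F = "{k \<in> carrier G. C k \<noteq> \<zero>\<^bsub>A\<^esub>}"
    have F: "?F \<subseteq> carrier G" "C \<in> ?F \<rightarrow> carrier A"
      using C by auto
    have "d = (\<Oplus>\<^bsub>Der A \<R>\<^esub>a\<in>?F. C a \<odot>\<^bsub>Der A \<R>\<^esub> ad \<R> (\<delta> a))"
    proof (rule Der_eqI[OF d closed[OF F(2)]])
      have "(if k \<in> ?F then C k else \<zero>\<^bsub>A\<^esub>) = C k" if "k \<in> carrier G" for k
        using that by auto
      then show "chi d g k = chi (\<Oplus>\<^bsub>Der A \<R>\<^esub>a\<in>?F. C a \<odot>\<^bsub>Der A \<R>\<^esub> ad \<R> (\<delta> a)) g k"
        if "g \<in> carrier G" "k \<in> carrier G" for g k
        using that chi_inner[OF fin F that] chi[OF that] by simp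
    qed
    then show "d \<in> carrier (Inn A G)"
      using fin F unfolding Inn_def by auto
  }
qed

end

section \<open>Conjugacy classes and the splitting\<close>

context group
begin

lemma cancel_inv_left:
  "\<lbrakk>x \<in> carrier G; y \<in> carrier G\<rbrakk> \<Longrightarrow> x \<otimes> (inv x \<otimes> y) = y"
  "\<lbrakk>x \<in> carrier G; y \<in> carrier G\<rbrakk> \<Longrightarrow> inv x \<otimes> (x \<otimes> y) = y"
  by (simp_all add: m_assoc[symmetric])

lemma conj_orbit:
  assumes "u \<in> carrier G"
  shows "orbit G (conj_action G) u = {g \<otimes> u \<otimes> inv g | g. g \<in> carrier G}"
  using assms by (auto simp: orbit_def conj_action_def)

lemma conj_orbit_self:
  assumes u: "u \<in> carrier G"
  shows "u \<in> orbit G (conj_action G) u"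
  unfolding conj_orbit[OF u] using u by (auto intro!: exI[of _ \<one>])

text \<open>Right translation of the conjugating element by a, or by its inverse, carries one
  description of the orbit into the other.\<close>

lemma conj_orbit_conj:
  assumes a: "a \<in> carrier G" and u: "u \<in> carrier G"
  shows "orbit G (conj_action G) (a \<otimes> u \<otimes> inv a) = orbit G (conj_action G) u"
proof -
  have 1: "g \<otimes> (a \<otimes> u \<otimes> inv a) \<otimes> inv g = (g \<otimes> a) \<otimes> u \<otimes> inv (g \<otimes> a)" if "g \<in> carrier G" for g
    using that a u by (simp add: inv_mult_group m_assoc)
  have 2: "g \<otimes> u \<otimes> inv g = (g \<otimes> inv a) \<otimes> (a \<otimes> u \<otimes> inv a) \<otimes> inv (g \<otimes> inv a)"
    if "g \<in> carrier G" for g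
    using that a u by (simp add: inv_mult_group m_assoc cancel_inv_left)
  have "a \<otimes> u \<otimes> inv a \<in> carrier G"
    using a u by simp
  then show ?thesis
    unfolding conj_orbit[OF u] conj_orbit[OF \<open>a \<otimes> u \<otimes> inv a \<in> carrier G\<close>]
  proof (intro equalityI subsetI; elim CollectE exE conjE)
    fix x g assume "x = g \<otimes> (a \<otimes> u \<otimes> inv a) \<otimes> inv g" "g \<in> carrier G"
    then show "x \<in> {g \<otimes> u \<otimes> inv g | g. g \<in> carrier G}"
      using 1[of g] a by (intro CollectI exI[of _ "g \<otimes> a"] conjI) simp_all
  next
    fix x g assume "x = g \<otimes> u \<otimes> inv g" "g \<in> carrier G"
    then show "x \<in> {g \<otimes> (a \<otimes> u \<otimes> inv a) \<otimes> inv g | g. g \<in> carrier G}"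
      using 2[of g] a by (intro CollectI exI[of _ "g \<otimes> inv a"] conjI) (simp, simp)
  qed
qed

lemma conj_orbit_conj_inv:
  assumes "a \<in> carrier G" "u \<in> carrier G"
  shows "orbit G (conj_action G) (inv a \<otimes> u \<otimes> a) = orbit G (conj_action G) u"
  using conj_orbit_conj[of "inv a" u] assms by simp

lemma conj_orbit_in_classes:
  "u \<in> carrier G \<Longrightarrow> orbit G (conj_action G) u \<in> conj_classes G"
  by (auto simp: conj_classes_def orbits_def)

lemma conj_classes_mem:
  assumes "K \<in> conj_classes G" "u \<in> K"
  shows "u \<in> carrier G" and "orbit G (conj_action G) u = K"
proof -
  obtain w where w: "w \<in> carrier G" and K: "K = orbit G (conj_action G) w"
    using assms(1) by (auto simp: conj_classes_def orbits_def)
  obtain g where "g \<in> carrier G" "u = g \<otimes> w \<otimes> inv g"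
    using assms(2) conj_orbit[OF w] K by auto
  then show "u \<in> carrier G" "orbit G (conj_action G) u = K"
    using w K conj_orbit_conj by auto
qed

lemma subgroup_centralizer:
  assumes u: "u \<in> carrier G"
  shows "subgroup (centralizer G u) G"
proof
  fix x y assume "x \<in> centralizer G u" "y \<in> centralizer G u"
  then have x: "x \<in> carrier G" "x \<otimes> u = u \<otimes> x" and y: "y \<in> carrier G" "y \<otimes> u = u \<otimes> y"
    by (auto simp: centralizer_def)
  have "x \<otimes> y \<otimes> u = x \<otimes> u \<otimes> y"
    using x(1) y u by (simp add: m_assoc)
  also have "\<dots> = u \<otimes> (x \<otimes> y)"
    using x y(1) u by (simp add: m_assoc)
  finally show "x \<otimes> y \<in> centralizer G u"
    using x(1) y(1) by (simp add: centralizer_def)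
next
  fix x assume "x \<in> centralizer G u"
  then have x: "x \<in> carrier G" "x \<otimes> u = u \<otimes> x"
    by (auto simp: centralizer_def)
  then have "inv x \<otimes> (x \<otimes> u) \<otimes> inv x = inv x \<otimes> (u \<otimes> x) \<otimes> inv x"
    by simp
  then have "u \<otimes> inv x = inv x \<otimes> u"
    using x(1) u by (simp add: m_assoc cancel_inv_left)
  then show "inv x \<in> centralizer G u"
    using x(1) by (simp add: centralizer_def)
qed (use u in \<open>auto simp: centralizer_def\<close>)

end

section \<open>Centralizers of representatives and transversals\<close>

locale fg_FC_group_algebra = group_algebra +
  fixes rep :: "'a set \<Rightarrow> 'a"
  assumes fg: "finitely_generated_group G"
    and FC: "FC_group G"
    and rep: "K \<in> conj_classes G \<Longrightarrow> rep K \<in> K"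
begin

abbreviation cl :: "'a \<Rightarrow> 'a set" where
  "cl \<equiv> orbit G (conj_action G)"

abbreviation Z :: "'a set \<Rightarrow> 'a set" where
  "Z K \<equiv> centralizer G (rep K)"

abbreviation H :: "'a set \<Rightarrow> ('c, 'a \<Rightarrow> 'c) module" where
  "H K \<equiv> Hom_Ab (G\<lparr>carrier := Z K\<rparr>) A"

abbreviation S :: "('c, 'a set \<Rightarrow> 'a \<Rightarrow> 'c) module" where
  "S \<equiv> mod_direct_sum (conj_classes G) H"

lemma finite_class: "K \<in> conj_classes G \<Longrightarrow> finite K"
  using FC by (simp add: FC_group_def)

lemma rep_carrier [simp]: "K \<in> conj_classes G \<Longrightarrow> rep K \<in> carrier G"
  using conj_classes_mem(1) rep by blast

lemma cl_rep: "K \<in> conj_classes G \<Longrightarrow> cl (rep K) = K"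
  using conj_classes_mem(2) rep by blast

lemma Z_subgroup: "K \<in> conj_classes G \<Longrightarrow> subgroup (Z K) G"
  by (simp add: subgroup_centralizer)

lemma Z_carrier: "z \<in> Z K \<Longrightarrow> z \<in> carrier G"
  by (simp add: centralizer_def)

lemma H_module: "K \<in> conj_classes G \<Longrightarrow> module A (H K)"
  by (intro module_Hom_Ab A.is_cring subgroup.subgroup_is_group[OF Z_subgroup] group_axioms)

lemma S_module: "module A S"
  by (rule module_mod_direct_sum[OF A.is_cring H_module])

lemma H_memD:
  assumes "f \<in> carrier (H K)"
  shows "z \<in> Z K \<Longrightarrow> f z \<in> carrier A"
    and "\<lbrakk>z \<in> Z K; w \<in> Z K\<rbrakk> \<Longrightarrow> f (z \<otimes> w) = f z \<oplus>\<^bsub>A\<^esub> f w"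
    and "f \<in> extensional (Z K)"
  using assms by (auto simp: Hom_Ab_def hom_def)

text \<open>A homomorphism into an abelian group is invariant under conjugation. This compensates
  for the transversal not being normalized: the element chosen for \<open>rep K\<close> need not be
  the identity.\<close>

lemma H_conj:
  assumes K: "K \<in> conj_classes G" and f: "f \<in> carrier (H K)" and t: "t \<in> Z K" and z: "z \<in> Z K"
  shows "f (inv t \<otimes> z \<otimes> t) = f z"
proof -
  interpret Z: subgroup "Z K" G using Z_subgroup[OF K] .
  have 0: "f \<one> = \<zero>\<^bsub>A\<^esub>"
    using H_memD(2)[OF f Z.one_closed Z.one_closed] H_memD(1)[OF f Z.one_closed]
    by (simp add: A.add.r_cancel_one')
  have "f (inv t \<otimes> z \<otimes> t) = f z \<oplus>\<^bsub>A\<^esub> (f (inv t) \<oplus>\<^bsub>A\<^esub> f t)"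
    using t z by (simp add: H_memD[OF f] A.a_ac)
  also have "f (inv t) \<oplus>\<^bsub>A\<^esub> f t = \<zero>\<^bsub>A\<^esub>"
    using H_memD(2)[OF f, of "inv t" t] t 0 by (simp add: Z_carrier)
  finally show ?thesis
    using H_memD(1)[OF f z] by simp
qed

text \<open>The class of k is the coset space of the centralizer of its representative, and
  \<open>transv k\<close> is an arbitrary element of the coset belonging to k.\<close>

definition transv :: "'a \<Rightarrow> 'a" where
  "transv k = (SOME t. t \<in> carrier G \<and> k = t \<otimes> rep (cl k) \<otimes> inv t)"

lemma transv:
  assumes k: "k \<in> carrier G"
  shows "transv k \<in> carrier G" and "transv k \<otimes> rep (cl k) \<otimes> inv (transv k) = k"
    and "k \<otimes> transv k = transv k \<otimes> rep (cl k)"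
proof -
  note K = conj_orbit_in_classes[OF k]
  have "k \<in> cl (rep (cl k))"
    using conj_orbit_self[OF k] cl_rep[OF K] by simp
  then have "\<exists>t. t \<in> carrier G \<and> k = t \<otimes> rep (cl k) \<otimes> inv t"
    using conj_orbit[OF rep_carrier[OF K]] by blast
  from someI_ex[OF this] show t: "transv k \<in> carrier G" and e: "transv k \<otimes> rep (cl k) \<otimes> inv (transv k) = k"
    unfolding transv_def by auto
  have "k \<otimes> transv k = (transv k \<otimes> rep (cl k) \<otimes> inv (transv k)) \<otimes> transv k"
    using e by simp
  then show "k \<otimes> transv k = transv k \<otimes> rep (cl k)"
    using t K by (simp add: m_assoc)
qed

text \<open>\<open>coset_elt g k\<close> is the element of \<open>Z(u)\<close> by which \<open>g\<close> acts between the cosets of \<open>transv (g\<inverse> k g)\<close> and \<open>transv k\<close>.\<close>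

definition coset_elt :: "'a \<Rightarrow> 'a \<Rightarrow> 'a" where
  "coset_elt g k = inv (transv k) \<otimes> g \<otimes> transv (inv g \<otimes> k \<otimes> g)"

lemma coset_elt_carrier [simp]: "\<lbrakk>g \<in> carrier G; k \<in> carrier G\<rbrakk> \<Longrightarrow> coset_elt g k \<in> carrier G"
  by (simp add: coset_elt_def transv)

lemma transv_coset_elt:
  assumes g: "g \<in> carrier G" and k: "k \<in> carrier G"
  shows "transv k \<otimes> coset_elt g k = g \<otimes> transv (inv g \<otimes> k \<otimes> g)"
  using assms by (simp add: coset_elt_def transv m_assoc cancel_inv_left)

text \<open>The points k and g^-1 k g have the same representative u. Both \<open>transv k\<close>
  and g times the transversal element of g^-1 k g conjugate u to k, so they differ on the right by
  an element centralizing u.\<close>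

lemma coset_elt_in_Z:
  assumes g: "g \<in> carrier G" and k: "k \<in> carrier G"
  shows "coset_elt g k \<in> Z (cl k)"
proof -
  let ?k = "inv g \<otimes> k \<otimes> g" and ?u = "rep (cl k)"
  have k': "?k \<in> carrier G" and cl: "cl ?k = cl k"
    using g k by (simp_all add: conj_orbit_conj_inv)
  have u: "?u \<in> carrier G"
    using k by (simp add: conj_orbit_in_classes)
  note t = transv(1)[OF k] and t' = transv(1)[OF k']
  have "transv k \<otimes> (coset_elt g k \<otimes> ?u) = g \<otimes> (transv ?k \<otimes> ?u)"
    using g k t t' u transv_coset_elt[OF g k] by (simp add: m_assoc[symmetric])
  also have "\<dots> = g \<otimes> (?k \<otimes> transv ?k)"
    using transv(3)[OF k'] cl by simp
  also have "\<dots> = k \<otimes> (g \<otimes> transv ?k)"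
    using g k t' by (simp add: m_assoc cancel_inv_left)
  also have "\<dots> = k \<otimes> (transv k \<otimes> coset_elt g k)"
    using transv_coset_elt[OF g k] by simp
  also have "\<dots> = transv k \<otimes> (?u \<otimes> coset_elt g k)"
    using g k t u transv(3)[OF k] by (simp add: m_assoc[symmetric])
  finally have "coset_elt g k \<otimes> ?u = ?u \<otimes> coset_elt g k"
    using g k t u by simp
  then show ?thesis
    using g k by (simp add: centralizer_def)
qed

text \<open>The transversal element at the intermediate point g^-1 k g cancels against its inverse.
  After a homomorphism on the centralizer is applied, this becomes the cocycle identity.\<close>

lemma coset_elt_mult:
  assumes g: "g \<in> carrier G" and h: "h \<in> carrier G" and k: "k \<in> carrier G"
  shows "coset_elt (g \<otimes> h) k = coset_elt g k \<otimes> coset_elt h (inv g \<otimes> k \<otimes> g)"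
proof -
  let ?k = "inv g \<otimes> k \<otimes> g"
  have k': "?k \<in> carrier G" and e: "inv (g \<otimes> h) \<otimes> k \<otimes> (g \<otimes> h) = inv h \<otimes> ?k \<otimes> h"
    using g h k by (simp_all add: inv_mult_group m_assoc)
  have k'': "inv h \<otimes> ?k \<otimes> h \<in> carrier G"
    using k' h by simp
  have "transv k \<otimes> coset_elt (g \<otimes> h) k = g \<otimes> (h \<otimes> transv (inv h \<otimes> ?k \<otimes> h))"
    using transv_coset_elt[of "g \<otimes> h" k] e g h k transv(1)[OF k''] by (simp add: m_assoc)
  also have "\<dots> = g \<otimes> (transv ?k \<otimes> coset_elt h ?k)"
    using transv_coset_elt[OF h k'] by simp
  also have "\<dots> = (g \<otimes> transv ?k) \<otimes> coset_elt h ?k"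
    using g h k' transv(1)[OF k'] by (simp add: m_assoc)
  also have "\<dots> = transv k \<otimes> (coset_elt g k \<otimes> coset_elt h ?k)"
    using transv_coset_elt[OF g k] g h k k' transv(1)[OF k] by (simp add: m_assoc[symmetric])
  finally show ?thesis
    using g h k k' transv(1)[OF k] by simp
qed

text \<open>For a fixed class K, the elements g whose cocycle value vanishes on all of K form a
  subgroup: the cocycle identity moves points only inside K. A class can therefore be active only if
  some generator is active on it, and each generator has finitely many nonzero coefficients.\<close>

lemma finite_active_classes:
  assumes d: "d \<in> carrier (Der A \<R>)"
  shows "finite {K \<in> conj_classes G. \<exists>g \<in> carrier G. \<exists>k \<in> K. chi d g k \<noteq> \<zero>\<^bsub>A\<^esub>}"
proof -
  obtain T where T: "finite T" "T \<subseteq> carrier G" "generate G T = carrier G"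
    using fg by (auto simp: finitely_generated_group_def)
  \<comment> \<open>The classes met by the cocycle values of the finitely many generators.\<close>
  let ?B = "\<Union>s\<in>T. cl ` {k \<in> carrier G. chi d s k \<noteq> \<zero>\<^bsub>A\<^esub>}"
  have "chi d g k = \<zero>\<^bsub>A\<^esub>" if K: "K \<in> conj_classes G" "K \<notin> ?B" and g: "g \<in> carrier G" and k: "k \<in> K" for K g k
  proof -
    have KD: "x \<in> carrier G" "cl x = K" if "x \<in> K" for x
      using conj_classes_mem[OF K(1) that] by auto
    have KI: "inv a \<otimes> x \<otimes> a \<in> K" "a \<otimes> x \<otimes> inv a \<in> K" if "x \<in> K" "a \<in> carrier G" for x a
      using that KD[OF that(1)] conj_orbit_self[of "inv a \<otimes> x \<otimes> a"] conj_orbit_self[of "a \<otimes> x \<otimes> inv a"]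
      by (simp_all add: conj_orbit_conj_inv conj_orbit_conj)
    have gen: "chi d s x = \<zero>\<^bsub>A\<^esub>" if "s \<in> T" "x \<in> K" for s x
      using K(2) that KD[OF that(2)] by auto
    have "g \<in> generate G T"
      using g T by simp
    then show ?thesis
      using k
    proof (induction arbitrary: k rule: generate.induct)
      case one
      then show ?case using chi_one[OF d] KD by simp
    next
      case (incl s)
      then show ?case using gen by simp
    next
      case (inv s)
      then show ?case using chi_inv[OF d] gen KI KD T by auto
    next
      case (eng a b)
      then show ?case using chi_cocycle[OF d] KI KD T by auto
    qed
  qed
  then have "{K \<in> conj_classes G. \<exists>g \<in> carrier G. \<exists>k \<in> K. chi d g k \<noteq> \<zero>\<^bsub>A\<^esub>} \<subseteq> ?B"
    by blast
  moreover have "finite ?B"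
    using T finite_chi[OF d] by auto
  ultimately show ?thesis
    by (rule finite_subset)
qed

section \<open>Restriction to centralizers and its section\<close>

definition res :: "(('a \<Rightarrow> 'c) \<Rightarrow> 'a \<Rightarrow> 'c) \<Rightarrow> 'a set \<Rightarrow> 'a \<Rightarrow> 'c" where
  "res d = (\<lambda>K\<in>conj_classes G. \<lambda>z\<in>Z K. chi d z (rep K))"

lemma res_apply: "\<lbrakk>K \<in> conj_classes G; z \<in> Z K\<rbrakk> \<Longrightarrow> res d K z = chi d z (rep K)"
  by (simp add: res_def)

lemma Z_fix:
  assumes "K \<in> conj_classes G" "z \<in> Z K"
  shows "inv z \<otimes> rep K \<otimes> z = rep K"
proof -
  have "z \<in> carrier G" "rep K \<otimes> z = z \<otimes> rep K"
    using assms(2) by (simp_all add: centralizer_def)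
  then show ?thesis
    using assms(1) by (simp add: m_assoc cancel_inv_left)
qed

lemma S_carrier: "x \<in> carrier S \<longleftrightarrow>
    x \<in> (\<Pi>\<^sub>E K\<in>conj_classes G. carrier (H K)) \<and> finite {K \<in> conj_classes G. x K \<noteq> \<zero>\<^bsub>H K\<^esub>}"
  by (simp add: mod_direct_sum_def)

text \<open>Elements of \<open>Z K\<close> fix \<open>rep K\<close> under conjugation, so the
  cocycle identity at that point loses its twist and becomes additivity. A nonzero component makes
  its class active, which bounds the number of such components.\<close>

lemma res_closed:
  assumes d: "d \<in> carrier (Der A \<R>)"
  shows "res d \<in> carrier S"
proof -
  have "res d K \<in> carrier (H K)" if K: "K \<in> conj_classes G" for K
  proof -
    have "(\<lambda>z\<in>Z K. chi d z (rep K)) \<in> hom (G\<lparr>carrier := Z K\<rparr>) (add_monoid A)"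
      using K d Z_carrier subgroup.m_closed[OF Z_subgroup[OF K]]
      by (intro homI) (auto simp: chi_cocycle Z_fix)
    then show ?thesis
      using K by (simp add: Hom_Ab_def res_def)
  qed
  moreover have "finite {K \<in> conj_classes G. res d K \<noteq> \<zero>\<^bsub>H K\<^esub>}"
  proof (rule finite_subset[OF _ finite_active_classes[OF d]], safe)
    fix K assume K: "K \<in> conj_classes G" and ne: "res d K \<noteq> \<zero>\<^bsub>H K\<^esub>"
    then obtain z where "z \<in> Z K" "chi d z (rep K) \<noteq> \<zero>\<^bsub>A\<^esub>"
      by (auto simp: res_def Hom_Ab_def fun_eq_iff split: if_splits)
    then show "\<exists>g\<in>carrier G. \<exists>k\<in>K. chi d g k \<noteq> \<zero>\<^bsub>A\<^esub>"
      using rep[OF K] Z_carrier by blast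
  qed
  ultimately show ?thesis
    by (auto simp: S_carrier res_def)
qed

lemma res_hom: "res \<in> mod_hom A (Der A \<R>) S"
proof (rule mod_homI)
  show "res (d \<oplus>\<^bsub>Der A \<R>\<^esub> e) = res d \<oplus>\<^bsub>S\<^esub> res e" for d e
    by (auto simp: res_def mod_direct_sum_def Hom_Ab_def fun_eq_iff chi_add Z_carrier)
  show "res (c \<odot>\<^bsub>Der A \<R>\<^esub> d) = c \<odot>\<^bsub>S\<^esub> res d" for c d
    by (auto simp: res_def mod_direct_sum_def Hom_Ab_def fun_eq_iff chi_smult Z_carrier)
qed (rule res_closed)

text \<open>The inverse of Shapiro's isomorphism on cocycles.\<close>

definition sec :: "('a set \<Rightarrow> 'a \<Rightarrow> 'c) \<Rightarrow> ('a \<Rightarrow> 'c) \<Rightarrow> 'a \<Rightarrow> 'c" where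
  "sec \<phi> = der_of (\<lambda>g k. \<phi> (cl k) (coset_elt g k))"

context
  fixes \<phi> assumes \<phi>: "\<phi> \<in> carrier S"
begin

lemma S_component: "K \<in> conj_classes G \<Longrightarrow> \<phi> K \<in> carrier (H K)"
  using \<phi> by (auto simp: S_carrier)

text \<open>Conjugate points share their class, so the same homomorphism is applied to both factors
  of \<open>coset_elt_mult\<close>.\<close>

lemma sec_cocycle:
  shows "\<lbrakk>g \<in> carrier G; k \<in> carrier G\<rbrakk> \<Longrightarrow> \<phi> (cl k) (coset_elt g k) \<in> carrier A"
    and "g \<in> carrier G \<Longrightarrow> finite {k \<in> carrier G. \<phi> (cl k) (coset_elt g k) \<noteq> \<zero>\<^bsub>A\<^esub>}"
    and "\<lbrakk>g \<in> carrier G; h \<in> carrier G; k \<in> carrier G\<rbrakk> \<Longrightarrow> \<phi> (cl k) (coset_elt (g \<otimes> h) k) =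
      \<phi> (cl k) (coset_elt g k) \<oplus>\<^bsub>A\<^esub> \<phi> (cl (inv g \<otimes> k \<otimes> g)) (coset_elt h (inv g \<otimes> k \<otimes> g))"
proof -
  show "\<phi> (cl k) (coset_elt g k) \<in> carrier A" if "g \<in> carrier G" "k \<in> carrier G"
    using H_memD(1)[OF S_component] coset_elt_in_Z that conj_orbit_in_classes by blast
  show "finite {k \<in> carrier G. \<phi> (cl k) (coset_elt g k) \<noteq> \<zero>\<^bsub>A\<^esub>}" if g: "g \<in> carrier G"
  proof (rule finite_subset)
    \<comment> \<open>Nonzero values can occur only on classes where \<open>\<phi>\<close> has a
      nonzero component: finitely many classes, each of them finite.\<close>
    let ?I = "{K \<in> conj_classes G. \<phi> K \<noteq> \<zero>\<^bsub>H K\<^esub>}"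
    show "finite (\<Union>?I)"
      using \<phi> finite_class by (auto simp: S_carrier)
    show "{k \<in> carrier G. \<phi> (cl k) (coset_elt g k) \<noteq> \<zero>\<^bsub>A\<^esub>} \<subseteq> \<Union>?I"
    proof safe
      fix k assume k: "k \<in> carrier G" and ne: "\<phi> (cl k) (coset_elt g k) \<noteq> \<zero>\<^bsub>A\<^esub>"
      have "\<phi> (cl k) \<noteq> \<zero>\<^bsub>H (cl k)\<^esub>"
        using ne coset_elt_in_Z[OF g k] by (auto simp: Hom_Ab_def)
      then show "k \<in> \<Union>?I"
        using conj_orbit_in_classes[OF k] conj_orbit_self[OF k] by blast
    qed
  qed
  show "\<phi> (cl k) (coset_elt (g \<otimes> h) k) =
      \<phi> (cl k) (coset_elt g k) \<oplus>\<^bsub>A\<^esub> \<phi> (cl (inv g \<otimes> k \<otimes> g)) (coset_elt h (inv g \<otimes> k \<otimes> g))"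
    if g: "g \<in> carrier G" and h: "h \<in> carrier G" and k: "k \<in> carrier G"
  proof -
    have cl: "cl (inv g \<otimes> k \<otimes> g) = cl k"
      using g k by (simp add: conj_orbit_conj_inv)
    have "coset_elt h (inv g \<otimes> k \<otimes> g) \<in> Z (cl k)"
      using coset_elt_in_Z[of h "inv g \<otimes> k \<otimes> g"] g h k cl by simp
    then show ?thesis
      using H_memD(2)[OF S_component[OF conj_orbit_in_classes[OF k]]] coset_elt_in_Z[OF g k] coset_elt_mult[OF g h k] cl
      by simp
  qed
qed

lemma sec_closed: "sec \<phi> \<in> carrier (Der A \<R>)"
  unfolding sec_def by (rule der_of_in_Der; (rule sec_cocycle; assumption))

lemma chi_sec: "\<lbrakk>g \<in> carrier G; k \<in> carrier G\<rbrakk> \<Longrightarrow> chi (sec \<phi>) g k = \<phi> (cl k) (coset_elt g k)"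
  unfolding sec_def by (rule chi_der_of; (assumption | (rule sec_cocycle; assumption)))

lemma res_sec: "res (sec \<phi>) = \<phi>"
proof (rule extensionalityI[where A = "conj_classes G"])
  show "\<phi> \<in> extensional (conj_classes G)"
    using \<phi> by (auto simp: S_carrier PiE_iff)
  fix K assume K: "K \<in> conj_classes G"
  show "res (sec \<phi>) K = \<phi> K"
  proof (rule extensionalityI[where A = "Z K"])
    show "\<phi> K \<in> extensional (Z K)"
      using H_memD(3)[OF S_component[OF K]] .
    fix z assume z: "z \<in> Z K"
    \<comment> \<open>As z fixes \<open>rep K\<close>, both transversal elements in
      \<open>coset_elt z (rep K)\<close> are \<open>?t\<close>. It centralizes \<open>rep K\<close>,
      so conjugation by it does not change the value of the homomorphism.\<close>
    let ?t = "transv (rep K)"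
    have t: "?t \<in> Z K"
      using transv[OF rep_carrier[OF K]] K by (simp add: cl_rep centralizer_def)
    have "res (sec \<phi>) K z = \<phi> K (inv ?t \<otimes> z \<otimes> ?t)"
      using K z by (simp add: res_apply chi_sec Z_carrier cl_rep coset_elt_def Z_fix)
    then show "res (sec \<phi>) K z = \<phi> K z"
      using H_conj[OF K S_component[OF K] t z] by simp
  qed (use K in \<open>simp add: res_def\<close>)
qed (simp add: res_def)

end

lemma sec_hom: "sec \<in> mod_hom A S (Der A \<R>)"
proof -
  interpret S: module A S by (rule S_module)
  show ?thesis
  proof (rule mod_homI)
    fix \<phi> \<psi> assume p: "\<phi> \<in> carrier S" "\<psi> \<in> carrier S"
    show "sec (\<phi> \<oplus>\<^bsub>S\<^esub> \<psi>) = sec \<phi> \<oplus>\<^bsub>Der A \<R>\<^esub> sec \<psi>"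
    proof (rule Der_eqI)
      fix g k assume gk: "g \<in> carrier G" "k \<in> carrier G"
      have "(\<phi> \<oplus>\<^bsub>S\<^esub> \<psi>) (cl k) (coset_elt g k) = \<phi> (cl k) (coset_elt g k) \<oplus>\<^bsub>A\<^esub> \<psi> (cl k) (coset_elt g k)"
        using conj_orbit_in_classes[OF gk(2)] coset_elt_in_Z[OF gk] by (simp add: mod_direct_sum_def Hom_Ab_def)
      then show "chi (sec (\<phi> \<oplus>\<^bsub>S\<^esub> \<psi>)) g k = chi (sec \<phi> \<oplus>\<^bsub>Der A \<R>\<^esub> sec \<psi>) g k"
        using p gk by (simp add: chi_add chi_sec)
    qed (use p in \<open>simp_all add: sec_closed\<close>)
  next
    fix c \<phi> assume p: "c \<in> carrier A" "\<phi> \<in> carrier S"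
    show "sec (c \<odot>\<^bsub>S\<^esub> \<phi>) = c \<odot>\<^bsub>Der A \<R>\<^esub> sec \<phi>"
    proof (rule Der_eqI)
      fix g k assume gk: "g \<in> carrier G" "k \<in> carrier G"
      have "(c \<odot>\<^bsub>S\<^esub> \<phi>) (cl k) (coset_elt g k) = c \<otimes>\<^bsub>A\<^esub> \<phi> (cl k) (coset_elt g k)"
        using conj_orbit_in_classes[OF gk(2)] coset_elt_in_Z[OF gk] by (simp add: mod_direct_sum_def Hom_Ab_def)
      then show "chi (sec (c \<odot>\<^bsub>S\<^esub> \<phi>)) g k = chi (c \<odot>\<^bsub>Der A \<R>\<^esub> sec \<phi>) g k"
        using p gk by (simp add: chi_smult chi_sec)
    qed (use p in \<open>simp_all add: sec_closed\<close>)
  qed (rule sec_closed)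
qed

section \<open>The kernel of restriction\<close>

lemma res_zero_iff:
  "res d = \<zero>\<^bsub>S\<^esub> \<longleftrightarrow> (\<forall>K \<in> conj_classes G. \<forall>z \<in> Z K. chi d z (rep K) = \<zero>\<^bsub>A\<^esub>)"
  by (auto simp: res_def mod_direct_sum_def Hom_Ab_def fun_eq_iff)

text \<open>The cocycle is the coboundary of \<open>k \<mapsto> chi d (transv k) k\<close>: evaluate \<open>g transv(g\<inverse> k g) = transv(k) coset_elt g k\<close> at \<open>k\<close>.\<close>

lemma kernel_coboundary:
  assumes d: "d \<in> carrier (Der A \<R>)" and ker: "res d = \<zero>\<^bsub>S\<^esub>"
    and g: "g \<in> carrier G" and k: "k \<in> carrier G"
  shows "chi d g k = chi d (transv k) k \<ominus>\<^bsub>A\<^esub> chi d (transv (inv g \<otimes> k \<otimes> g)) (inv g \<otimes> k \<otimes> g)"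
proof -
  let ?k = "inv g \<otimes> k \<otimes> g"
  have k': "?k \<in> carrier G"
    using g k by simp
  note K = conj_orbit_in_classes[OF k]
  \<comment> \<open>The twist by \<open>transv k\<close> moves the evaluation point from k to the
    representative, where the kernel condition applies to \<open>coset_elt g k\<close>.\<close>
  have fix_transv: "inv (transv k) \<otimes> k \<otimes> transv k = rep (cl k)"
    using transv[OF k] K k by (simp add: m_assoc cancel_inv_left)
  have "chi d g k \<oplus>\<^bsub>A\<^esub> chi d (transv ?k) ?k = chi d (g \<otimes> transv ?k) k"
    using chi_cocycle[OF d g transv(1)[OF k'] k] by simp
  also have "\<dots> = chi d (transv k \<otimes> coset_elt g k) k"
    using transv_coset_elt[OF g k] by simp
  also have "\<dots> = chi d (transv k) k \<oplus>\<^bsub>A\<^esub> chi d (coset_elt g k) (rep (cl k))"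
    using chi_cocycle[OF d transv(1)[OF k] coset_elt_carrier[OF g k] k] fix_transv by simp
  also have "chi d (coset_elt g k) (rep (cl k)) = \<zero>\<^bsub>A\<^esub>"
    using ker K coset_elt_in_Z[OF g k] by (simp add: res_zero_iff)
  finally have "chi d g k \<oplus>\<^bsub>A\<^esub> chi d (transv ?k) ?k = chi d (transv k) k"
    using d k transv(1)[OF k] by simp
  moreover have "chi d (transv ?k) ?k \<in> carrier A" "chi d g k \<in> carrier A"
    using d g k k' transv(1)[OF k'] by simp_all
  ultimately show ?thesis
    by (metis A.minus_eq A.a_assoc A.r_neg A.r_zero A.a_inv_closed)
qed

text \<open>A coboundary at z in \<open>Z K\<close> and \<open>rep K\<close> is C (rep K) - C (rep
  K) = 0. Conversely, \<open>kernel_coboundary\<close> supplies the function \<open>C\<close>, and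
  only its finite support remains to be checked.\<close>

lemma Inn_eq_kernel: "carrier (Inn A G) = {d \<in> carrier (Der A \<R>). res d = \<zero>\<^bsub>S\<^esub>}"
proof (intro equalityI subsetI)
  fix d assume "d \<in> carrier (Inn A G)"
  then obtain C where d: "d \<in> carrier (Der A \<R>)" and C: "C \<in> carrier G \<rightarrow> carrier A"
    and chi: "\<And>g k. \<lbrakk>g \<in> carrier G; k \<in> carrier G\<rbrakk> \<Longrightarrow> chi d g k = C k \<ominus>\<^bsub>A\<^esub> C (inv g \<otimes> k \<otimes> g)"
    unfolding Inn_carrier_iff by blast
  have "res d = \<zero>\<^bsub>S\<^esub>"
    unfolding res_zero_iff
  proof (intro ballI)
    fix K z assume K: "K \<in> conj_classes G" and z: "z \<in> Z K"
    have "C (rep K) \<in> carrier A"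
      using C K by auto
    then show "chi d z (rep K) = \<zero>\<^bsub>A\<^esub>"
      using chi[of z "rep K"] K z by (simp add: Z_carrier Z_fix A.minus_eq A.r_neg)
  qed
  then show "d \<in> {d \<in> carrier (Der A \<R>). res d = \<zero>\<^bsub>S\<^esub>}"
    using d by simp
next
  fix d assume "d \<in> {d \<in> carrier (Der A \<R>). res d = \<zero>\<^bsub>S\<^esub>}"
  then have d: "d \<in> carrier (Der A \<R>)" and ker: "res d = \<zero>\<^bsub>S\<^esub>"
    by auto
  let ?C = "\<lambda>k. chi d (transv k) k"
  \<comment> \<open>The candidate vanishes off the active classes, and their union is finite because
    there are finitely many of them and each is finite.\<close>
  let ?I = "{K \<in> conj_classes G. \<exists>g \<in> carrier G. \<exists>k \<in> K. chi d g k \<noteq> \<zero>\<^bsub>A\<^esub>}"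
  have "{k \<in> carrier G. ?C k \<noteq> \<zero>\<^bsub>A\<^esub>} \<subseteq> \<Union>?I"
    using conj_orbit_in_classes conj_orbit_self transv(1) by blast
  moreover have "finite (\<Union>?I)"
    using finite_active_classes[OF d] finite_class by auto
  ultimately have "finite {k \<in> carrier G. ?C k \<noteq> \<zero>\<^bsub>A\<^esub>}"
    by (rule finite_subset)
  moreover have "?C \<in> carrier G \<rightarrow> carrier A"
    using d transv(1) by simp
  ultimately show "d \<in> carrier (Inn A G)"
    unfolding Inn_carrier_iff
    by (intro conjI d bexI[of _ ?C] ballI kernel_coboundary[OF d ker])
qed

text \<open>\<open>Inn A G\<close> inherits its operations from \<open>Der\<close> by record update,
  so equality of carriers becomes equality of records, in the shape required by
  \<open>split_epi_mod_isomorphic\<close>.\<close>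

lemma Inn_eq: "Inn A G = (Der A \<R>)\<lparr>carrier := {d \<in> carrier (Der A \<R>). res d = \<zero>\<^bsub>S\<^esub>}\<rparr>"
proof -
  have "Inn A G = (Der A \<R>)\<lparr>carrier := carrier (Inn A G)\<rparr>"
    by (simp add: Inn_def)
  then show ?thesis
    by (simp only: Inn_eq_kernel)
qed

lemma Der_decomposition: "mod_isomorphic A (Der A \<R>) (mod_prod (Inn A G) S)"
  unfolding Inn_eq
  by (rule split_epi_mod_isomorphic[OF Der.module_axioms S_module res_hom sec_hom]) (rule res_sec)

end

theorem theorem3p2:
  fixes G :: "('g, 'm) monoid_scheme"
    and A :: "('a, 'r) ring_scheme"
    and rep :: "'g set \<Rightarrow> 'g"
  assumes "finitely_generated_group G"
    and "FC_group G"
    and "cring A"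
    and "\<And>K. K \<in> conj_classes G \<Longrightarrow> rep K \<in> K"
  shows "mod_isomorphic A
    (Der A (group_ring A G))
    (mod_prod (Inn A G)
      (mod_direct_sum (conj_classes G)
        (\<lambda>K. Hom_Ab (G\<lparr>carrier := centralizer G (rep K)\<rparr>) A)))"
proof -
  have "group G"
    using assms(1) by (simp add: finitely_generated_group_def)
  then interpret fg_FC_group_algebra G A rep
    using assms by (simp add: fg_FC_group_algebra_def fg_FC_group_algebra_axioms_def group_algebra_def)
  show ?thesis
    by (rule Der_decomposition)
qed

end
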